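(* Let $R>0$ be fixed, and let $V:\mathbb{R}\to\mathbb{R}$ be a smooth function for which there is a constant $c_V>0$ with \[ tV'(t)\ \ge\ -c_V^2 \quad\text{and}\quad V''(t)\ \ge\ -c_V^2 \qquad\text{for all } t\in\mathbb{R}. \] Then there exists $L_0>0$ such that for every $0<L<L_0$ the following holds: if $\phi\in L^2_{2,\text{boundary}-0}(X_L)$ satisfies \[ \Delta\phi - V'(\phi)=0 \quad\text{on } X_L, \] then $\phi$ is independent of the $z$-direction, i.e. $\partial_z\phi=0$.
   Context: For $L>0$, $S^1_L=[0,L]/\!\sim$ is the circle of length $L$ with coordinate $z$, and $X_L=B^2(R)\times S^1_L$, where $B^2(R)\subset\mathbb{R}^2$ is the open disc of radius $R$, with the flat product metric; points are written $(x,z)$. $\Delta$ is the Laplacian of this flat metric. For a Riemannian manifold $M$ (possibly with boundary), $L^p_k(M)$ is the completion of $C^\infty(M)$ with respect to the norm $\|f\|_{L^p_k}=\sum_{i=0}^k\|\nabla^i f\|_{L^p}$, and $L^p_{k,\text{boundary}-0}(M)$ is the completion of compactly supported smooth functions (in the interior) in this norm (functions vanishing on the boundary). *)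

theory Defs
  imports "HOL-Analysis.Analysis"
begin

text \<open>Points of \<open>X_L = B^2(R) \<times> S^1_L\<close> are written \<open>(x, z)\<close> with \<open>x :: real \<times> real\<close>
  (Euclidean norm) and \<open>z :: real\<close>; functions on \<open>X_L\<close> are represented by functions on
  \<open>(real \<times> real) \<times> real\<close> which are \<open>L\<close>-periodic in \<open>z\<close>; integration over \<open>X_L\<close> is
  integration over the fundamental domain \<open>B^2(R) \<times> [0, L)\<close>.\<close>

fun Ck :: "nat \<Rightarrow> ('a::euclidean_space \<Rightarrow> real) \<Rightarrow> bool" where
  "Ck 0 f = continuous_on UNIV f"
| "Ck (Suc n) f = (f differentiable_on UNIV \<and>
      (\<forall>v. Ck n (\<lambda>p. frechet_derivative f (at p) v)))"

definition smooth_fun :: "('a::euclidean_space \<Rightarrow> real) \<Rightarrow> bool" where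
  "smooth_fun f = (\<forall>n. Ck n f)"

definition Dir :: "('a::euclidean_space \<Rightarrow> real) \<Rightarrow> 'a \<Rightarrow> 'a \<Rightarrow> real" where
  "Dir f v p = frechet_derivative f (at p) v"

definition zdir :: "(real \<times> real) \<times> real" where
  "zdir = ((0, 0), 1)"

definition XL :: "real \<Rightarrow> real \<Rightarrow> ((real \<times> real) \<times> real) set" where
  "XL R L = ball (0::real \<times> real) R \<times> {0..<L}"

text \<open>Smooth functions on \<open>X_L\<close> with compact support in the interior
  (extended by zero they are smooth, \<open>L\<close>-periodic in \<open>z\<close>, and vanish for \<open>|x| \<ge> r\<close>, some \<open>r < R\<close>).\<close>
definition test_fun :: "real \<Rightarrow> real \<Rightarrow> ((real \<times> real) \<times> real \<Rightarrow> real) \<Rightarrow> bool" where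
  "test_fun R L f \<longleftrightarrow> smooth_fun f \<and> (\<forall>x z. f (x, z + L) = f (x, z)) \<and>
     (\<exists>r<R. \<forall>x z. r \<le> norm x \<longrightarrow> f (x, z) = 0)"

definition L2_conv :: "real \<Rightarrow> real \<Rightarrow> (nat \<Rightarrow> (real \<times> real) \<times> real \<Rightarrow> real)
     \<Rightarrow> ((real \<times> real) \<times> real \<Rightarrow> real) \<Rightarrow> bool" where
  "L2_conv R L u g \<longleftrightarrow> g \<in> borel_measurable lborel \<and>
     ((\<lambda>n. \<integral>\<^sup>+ p\<in>XL R L. ennreal ((u n p - g p)\<^sup>2) \<partial>lborel) \<longlonglongrightarrow> 0)"

text \<open>\<open>phi \<in> L^2_{2,boundary-0}(X_L)\<close>: \<open>phi\<close> is the L^2 limit of a sequence of smooth functions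
  compactly supported in the interior which is Cauchy in the \<open>L^2_2\<close> norm; by completeness
  of L^2, the Cauchy property is expressed by L^2-convergence of all first derivatives
  (to \<open>G b\<close>, the weak derivative of \<open>phi\<close> along the basis vector \<open>b\<close>) and all second
  derivatives (to \<open>H b c\<close>, the weak second derivatives).\<close>
definition H2_0_approx :: "real \<Rightarrow> real \<Rightarrow> (nat \<Rightarrow> (real \<times> real) \<times> real \<Rightarrow> real)
     \<Rightarrow> ((real \<times> real) \<times> real \<Rightarrow> real)
     \<Rightarrow> ((real \<times> real) \<times> real \<Rightarrow> (real \<times> real) \<times> real \<Rightarrow> real)
     \<Rightarrow> ((real \<times> real) \<times> real \<Rightarrow> (real \<times> real) \<times> real \<Rightarrow> (real \<times> real) \<times> real \<Rightarrow> real)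
     \<Rightarrow> bool" where
  "H2_0_approx R L fs phi G H \<longleftrightarrow>
     (\<forall>n. test_fun R L (fs n)) \<and>
     L2_conv R L fs phi \<and>
     (\<forall>b\<in>Basis. L2_conv R L (\<lambda>n. Dir (fs n) b) (G b)) \<and>
     (\<forall>b\<in>Basis. \<forall>c\<in>Basis. L2_conv R L (\<lambda>n. Dir (Dir (fs n) b) c) (H b c))"

definition weak_laplacian ::
  "((real \<times> real) \<times> real \<Rightarrow> (real \<times> real) \<times> real \<Rightarrow> (real \<times> real) \<times> real \<Rightarrow> real)
     \<Rightarrow> (real \<times> real) \<times> real \<Rightarrow> real" where
  "weak_laplacian H p = (\<Sum>b\<in>Basis. H b b p)"

end

theory Submission
  imports Defs
begin

text \<open>Let \<open>\<tau>\<^sub>h\<close> be the rotation by \<open>h\<close> along the circle and \<open>u = \<phi> \<circ> \<tau>\<^sub>h - \<phi>\<close>. As \<open>V' + c\<^sup>2 t\<close> is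
  nondecreasing, \<open>u \<Delta>u = u (V'(\<phi> \<circ> \<tau>\<^sub>h) - V'(\<phi>)) \<ge> - c\<^sup>2 u\<^sup>2\<close> pointwise, hence
  \<open>\<integral> |\<partial>\<^sub>z u|\<^sup>2 \<le> \<integral> |\<nabla>u|\<^sup>2 \<le> c\<^sup>2 \<integral> u\<^sup>2\<close>. On each circle \<open>u\<close> has a zero, so
  \<open>\<integral> u\<^sup>2 \<le> L\<^sup>2 \<integral> |\<partial>\<^sub>z u|\<^sup>2\<close>, and \<open>c L < 1\<close> forces \<open>\<partial>\<^sub>z u = 0\<close>: the derivative \<open>\<partial>\<^sub>z \<phi>\<close> is
  invariant under all rotations. Having mean zero on each circle, it vanishes. Comparing
  \<open>\<phi>\<close> with its rotations instead of differentiating the equation avoids any bound on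
  \<open>V''(\<phi>)\<close> from above. Integration by parts, the Poincare inequality and the mean-zero property are
  only used for the approximating smooth functions.\<close>

section \<open>Rotations of the fundamental domain\<close>

lemma XL_borel [measurable]: "XL R L \<in> sets borel"
proof -
  have "ball (0::real \<times> real) R \<times> {0..<L} \<in> sets (borel \<Otimes>\<^sub>M borel)"
    by (intro pair_measureI) auto
  then show ?thesis unfolding XL_def borel_prod .
qed

abbreviation MX :: "real \<Rightarrow> real \<Rightarrow> ((real \<times> real) \<times> real) measure" where
  "MX R L \<equiv> restrict_space lborel (XL R L)"

lemma space_MX: "space (MX R L) = XL R L"
  by (simp add: space_restrict_space)

lemma nn_integral_MX:
  "(\<integral>\<^sup>+p. F p \<partial>MX R L) = (\<integral>\<^sup>+p. F p * indicator (XL R L) p \<partial>lborel)"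
  by (subst nn_integral_restrict_space) auto

lemma AE_MX: "(AE p in MX R L. P p) \<longleftrightarrow> (AE p in lborel. p \<in> XL R L \<longrightarrow> P p)"
  by (subst AE_restrict_space_iff) auto

lemma finite_measure_MX: "finite_measure (MX R L)"
proof -
  have "bounded (XL R L)"
    unfolding XL_def by (intro bounded_Times) auto
  then have "emeasure lborel (XL R L) < \<infinity>"
    using emeasure_bounded_finite by (metis infinity_ennreal_def)
  then show ?thesis
    by (intro finite_measureI) (simp add: emeasure_restrict_space space_restrict_space)
qed

lemma measurable_MX: "f \<in> borel_measurable borel \<Longrightarrow> f \<in> borel_measurable (MX R L)"
  by (rule measurable_restrict_space1) simp

text \<open>Rotation by \<open>h\<close> on the fundamental domain, for \<open>0 \<le> h \<le> L\<close>; needed because \<open>phi\<close>, \<open>G\<close>, \<open>H\<close>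
  are only meaningful on \<open>XL R L\<close> and need not be periodic.\<close>
definition Tz :: "real \<Rightarrow> real \<Rightarrow> (real \<times> real) \<times> real \<Rightarrow> (real \<times> real) \<times> real" where
  "Tz L h p = (if snd p < L - h then (fst p, snd p + h) else (fst p, snd p + (h - L)))"

lemma snd_less_borel: "{p :: (real \<times> real) \<times> real. snd p < a} \<in> sets borel"
  by (intro borel_open open_Collect_less continuous_intros)

lemma snd_ge_borel: "{p :: (real \<times> real) \<times> real. a \<le> snd p} \<in> sets borel"
  by (intro borel_closed closed_Collect_le continuous_intros)

lemma Tz_borel [measurable]: "Tz L h \<in> borel_measurable borel"
proof -
  \<comment> \<open>Indicators times constant vectors reduce measurability of this piecewise map to
    that of two half-spaces.\<close>
  have eq: "Tz L h p = p + indicator {p. snd p < L - h} p *\<^sub>R ((0,0),h)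
      + indicator {p. \<not> snd p < L - h} p *\<^sub>R ((0,0),h-L)" for p
    by (simp add: Tz_def prod_eq_iff)
  have "{p :: (real \<times> real) \<times> real. \<not> snd p < L - h} \<in> sets borel"
    unfolding not_less by (rule snd_ge_borel)
  then show ?thesis unfolding eq[abs_def]
    by (intro borel_measurable_add borel_measurable_scaleR borel_measurable_indicator
        borel_measurable_const snd_less_borel measurable_ident_sets refl)
qed

lemma Tz_in_XL: "0 \<le> h \<Longrightarrow> h \<le> L \<Longrightarrow> p \<in> XL R L \<Longrightarrow> Tz L h p \<in> XL R L"
  by (auto simp: XL_def Tz_def)

lemma nn_integral_lborel_translate:
  fixes F :: "'a::euclidean_space \<Rightarrow> ennreal"
  assumes [measurable]: "F \<in> borel_measurable borel"
  shows "(\<integral>\<^sup>+p. F (p + c) \<partial>lborel) = (\<integral>\<^sup>+p. F p \<partial>lborel)"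
proof -
  have "(\<integral>\<^sup>+p. F p \<partial>lborel) = (\<integral>\<^sup>+p. F p \<partial>distr lborel borel ((+) c))"
    by (simp add: lborel_distr_plus)
  also have "\<dots> = (\<integral>\<^sup>+p. F (c + p) \<partial>lborel)"
    by (subst nn_integral_distr) auto
  finally show ?thesis by (simp add: add.commute)
qed

text \<open>Cut and paste: the slabs \<open>snd p < L - h\<close> and
  \<open>L - h \<le> snd p\<close> of the domain are translated onto the slabs
  \<open>h \<le> snd p\<close> and \<open>snd p < h\<close>, which tile it again, and Lebesgue
  measure is translation invariant.\<close>

lemma nn_integral_Tz:
  assumes [measurable]: "F \<in> borel_measurable borel" and h: "0 \<le> h" "h \<le> L"
  shows "(\<integral>\<^sup>+p. F (Tz L h p) \<partial>MX R L) = (\<integral>\<^sup>+p. F p \<partial>MX R L)"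
proof -
  \<comment> \<open>\<open>A\<close> and \<open>B\<close> are \<open>F\<close> cut down to the
    images of the two slabs, so that each piece can be translated over the whole space.\<close>
  define A where "A = (\<lambda>p. F p * indicator (XL R L \<inter> {p. h \<le> snd p}) p)"
  define B where "B = (\<lambda>p. F p * indicator (XL R L \<inter> {p. snd p < h}) p)"
  have translate: "(\<lambda>p. f (p + c)) \<in> borel_measurable lborel" if "f \<in> borel_measurable borel"
    for f :: "(real \<times> real) \<times> real \<Rightarrow> ennreal" and c
    by (rule measurable_compose[OF _ that]) simp
  have A: "A \<in> borel_measurable borel"
    unfolding A_def by (rule borel_measurable_times_ennreal[OF assms(1)
        borel_measurable_indicator[OF sets.Int[OF XL_borel snd_ge_borel]]])
  have B: "B \<in> borel_measurable borel"
    unfolding B_def by (rule borel_measurable_times_ennreal[OF assms(1)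
        borel_measurable_indicator[OF sets.Int[OF XL_borel snd_less_borel]]])
  have pair0: "a + (0, 0) = a" for a :: "real \<times> real"
    by (simp add: prod_eq_iff)
  have eq: "F (Tz L h p) * indicator (XL R L) p = A (p + ((0,0),h)) + B (p + ((0,0),h-L))" for p
  proof (cases "p \<in> XL R L")
    case True
    show ?thesis
    proof (cases "snd p < L - h")
      case True
      then show ?thesis using \<open>p \<in> XL R L\<close> h
        by (cases p) (simp add: A_def B_def Tz_def XL_def indicator_def pair0)
    next
      case False
      then show ?thesis using \<open>p \<in> XL R L\<close> h
        by (cases p) (simp add: A_def B_def Tz_def XL_def indicator_def pair0)
    qed
  next
    case False
    then show ?thesis using h
      by (cases p) (auto simp: A_def B_def XL_def indicator_def pair0)
  qed
  have "(\<integral>\<^sup>+p. F (Tz L h p) \<partial>MX R L) =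
      (\<integral>\<^sup>+p. A (p + ((0,0),h)) + B (p + ((0,0),h-L)) \<partial>lborel)"
    unfolding nn_integral_MX by (simp only: eq)
  also have "\<dots> = (\<integral>\<^sup>+p. A (p + ((0,0),h)) \<partial>lborel) + (\<integral>\<^sup>+p. B (p + ((0,0),h-L)) \<partial>lborel)"
    by (intro nn_integral_add translate A B)
  also have "\<dots> = (\<integral>\<^sup>+p. A p \<partial>lborel) + (\<integral>\<^sup>+p. B p \<partial>lborel)"
    by (simp only: nn_integral_lborel_translate[OF A] nn_integral_lborel_translate[OF B])
  also have "\<dots> = (\<integral>\<^sup>+p. A p + B p \<partial>lborel)"
    by (rule nn_integral_add[symmetric]) (simp_all add: A B)
  also have "\<dots> = (\<integral>\<^sup>+p. F p \<partial>MX R L)"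
    unfolding nn_integral_MX by (intro nn_integral_cong) (simp add: A_def B_def indicator_def)
  finally show ?thesis .
qed

text \<open>Image measures carry \<open>nn_integral_Tz\<close> over to Bochner integrals without an
  integrability assumption. The identity also stands under \<open>distr\<close> because
  \<open>MX R L\<close> only has the trace sigma-algebra.\<close>

lemma distr_Tz:
  assumes h: "0 \<le> h" "h \<le> L"
  shows "distr (MX R L) borel (Tz L h) = distr (MX R L) borel (\<lambda>p. p)"
proof (rule measure_eqI)
  fix A assume "A \<in> sets (distr (MX R L) borel (Tz L h))"
  then have A: "A \<in> sets borel" by simp
  have eq: "emeasure (distr (MX R L) borel g) A = (\<integral>\<^sup>+p. indicator A (g p) \<partial>MX R L)"
    if "g \<in> borel_measurable borel" for g
  proof -
    have "emeasure (distr (MX R L) borel g) A = (\<integral>\<^sup>+p. indicator A p \<partial>distr (MX R L) borel g)"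
      using A by simp
    also have "\<dots> = (\<integral>\<^sup>+p. indicator A (g p) \<partial>MX R L)"
      by (rule nn_integral_distr) (simp_all add: A measurable_MX that borel_measurable_indicator)
    finally show ?thesis .
  qed
  show "emeasure (distr (MX R L) borel (Tz L h)) A = emeasure (distr (MX R L) borel (\<lambda>p. p)) A"
    unfolding eq[OF Tz_borel] eq[OF measurable_ident_sets[OF refl]]
    by (rule nn_integral_Tz[OF borel_measurable_indicator[OF A] h])
qed simp

lemma integral_Tz:
  fixes F :: "_ \<Rightarrow> real"
  assumes F: "F \<in> borel_measurable borel" and h: "0 \<le> h" "h \<le> L"
  shows "(\<integral>p. F (Tz L h p) \<partial>MX R L) = (\<integral>p. F p \<partial>MX R L)"
  using arg_cong[OF distr_Tz[OF h, of R], of "\<lambda>M. integral\<^sup>L M F"]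
  by (simp add: integral_distr[OF measurable_MX[OF Tz_borel] F]
      integral_distr[OF measurable_MX[OF measurable_ident_sets[OF refl]] F])

text \<open>The equation is known almost everywhere, yet it is also evaluated at rotated points. The
  exceptional set is enlarged to a Borel null set \<open>N\<close>, whose preimage in the domain is
  null by \<open>nn_integral_Tz\<close>.\<close>

lemma AE_Tz:
  assumes h: "0 \<le> h" "h \<le> L" and P: "AE p in MX R L. P p"
  shows "AE p in MX R L. P (Tz L h p)"
proof -
  have "AE p in lborel. p \<in> XL R L \<longrightarrow> P p" using P by (simp add: AE_MX)
  then obtain N where N: "N \<in> null_sets lborel" "{p. \<not> (p \<in> XL R L \<longrightarrow> P p)} \<subseteq> N"
    by (auto simp: eventually_ae_filter)
  then have N': "N \<in> sets borel" by auto
  have "(\<integral>\<^sup>+p. indicator N p \<partial>MX R L) = 0"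
  proof -
    have "(\<integral>\<^sup>+p. indicator N p \<partial>MX R L) \<le> (\<integral>\<^sup>+p. indicator N p \<partial>lborel)"
      unfolding nn_integral_MX by (intro nn_integral_mono) (simp add: indicator_def)
    also have "\<dots> = 0" using N(1) N' by (simp add: null_setsD1)
    finally show ?thesis by simp
  qed
  then have "(\<integral>\<^sup>+p. indicator N (Tz L h p) \<partial>MX R L) = 0"
    unfolding nn_integral_Tz[OF borel_measurable_indicator[OF N'] h] .
  then have "AE p in MX R L. indicator N (Tz L h p) = (0::ennreal)"
    by (subst (asm) nn_integral_0_iff_AE)
      (rule measurable_MX measurable_compose[OF Tz_borel] borel_measurable_indicator N')+
  then show ?thesis
  proof (rule AE_mp, intro AE_I2 impI)
    fix p assume "p \<in> space (MX R L)" "indicator N (Tz L h p) = (0::ennreal)"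
    then have "Tz L h p \<in> XL R L" "Tz L h p \<notin> N"
      using Tz_in_XL[OF h] by (auto simp: space_MX indicator_eq_0_iff)
    then show "P (Tz L h p)" using N(2) by blast
  qed
qed

section \<open>Periodic functions with support away from the boundary\<close>

lemma add_zero_pair: "x + (0, 0) = (x :: real \<times> real)"
  by (simp add: prod_eq_iff)

text \<open>Continuous functions on \<open>X\<^sub>L\<close> vanishing near the boundary, in the encoding of \<open>test_fun\<close>.\<close>
definition adm :: "real \<Rightarrow> real \<Rightarrow> ((real \<times> real) \<times> real \<Rightarrow> real) \<Rightarrow> bool" where
  "adm R L f \<longleftrightarrow> continuous_on UNIV f \<and> (\<forall>x z. f (x, z + L) = f (x, z)) \<and>
     (\<exists>r<R. \<forall>x z. r \<le> norm x \<longrightarrow> f (x, z) = 0)"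

text \<open>Only restrictions to lines parallel to \<open>b\<close> are differentiated, so that the
  product rule and the mean value theorem of one variable apply directly.\<close>

definition has_dd :: "'a::real_normed_vector \<Rightarrow> ('a \<Rightarrow> real) \<Rightarrow> ('a \<Rightarrow> real) \<Rightarrow> bool" where
  "has_dd b f f' \<longleftrightarrow> (\<forall>p t. ((\<lambda>t. f (p + t *\<^sub>R b)) has_real_derivative f' (p + t *\<^sub>R b)) (at t))"

lemma adm_continuous: "adm R L f \<Longrightarrow> continuous_on UNIV f"
  by (simp add: adm_def)

lemma adm_periodic: "adm R L f \<Longrightarrow> f (x, z + L) = f (x, z)"
  unfolding adm_def by blast

lemma adm_support:
  assumes "adm R L f"
  obtains r where "r < R" "\<And>x z. r \<le> norm x \<Longrightarrow> f (x, z) = 0"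
  using assms unfolding adm_def by blast

lemma admI:
  assumes "continuous_on UNIV f" "\<And>x z. f (x, z + L) = f (x, z)"
    "r < R" "\<And>x z. r \<le> norm x \<Longrightarrow> f (x, z) = 0"
  shows "adm R L f"
  using assms unfolding adm_def by blast

text \<open>The condition \<open>op 0 0 = 0\<close> makes the combination vanish beyond the larger
  of the two support radii.\<close>

lemma adm_binop:
  assumes f: "adm R L f" and g: "adm R L g"
    and op: "op 0 0 = 0" "\<And>f g :: (real \<times> real) \<times> real \<Rightarrow> real.
      continuous_on UNIV f \<Longrightarrow> continuous_on UNIV g \<Longrightarrow> continuous_on UNIV (\<lambda>p. op (f p) (g p))"
  shows "adm R L (\<lambda>p. op (f p) (g p))"
proof -
  obtain r where r: "r < R" "\<And>x z. r \<le> norm x \<Longrightarrow> f (x, z) = 0"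
    using f by (rule adm_support) blast
  obtain s where s: "s < R" "\<And>x z. s \<le> norm x \<Longrightarrow> g (x, z) = 0"
    using g by (rule adm_support) blast
  show ?thesis
    using r s by (intro admI[where r = "max r s"] op(2) adm_continuous[OF f] adm_continuous[OF g])
      (simp_all add: adm_periodic[OF f] adm_periodic[OF g] op(1))
qed

lemma adm_add: "adm R L f \<Longrightarrow> adm R L g \<Longrightarrow> adm R L (\<lambda>p. f p + g p)"
  by (rule adm_binop[where op = "(+)"]) (auto intro!: continuous_intros)

lemma adm_diff: "adm R L f \<Longrightarrow> adm R L g \<Longrightarrow> adm R L (\<lambda>p. f p - g p)"
  by (rule adm_binop[where op = "(-)"]) (auto intro!: continuous_intros)

lemma adm_mult: "adm R L f \<Longrightarrow> adm R L g \<Longrightarrow> adm R L (\<lambda>p. f p * g p)"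
  by (rule adm_binop[where op = "(*)"]) (auto intro!: continuous_intros)

lemma adm_cmult: "adm R L f \<Longrightarrow> adm R L (\<lambda>p. c * f p)"
  by (rule adm_binop[where op = "\<lambda>x y. c * x" and g = f]) (auto intro!: continuous_intros)

lemma adm_power2: "adm R L f \<Longrightarrow> adm R L (\<lambda>p. (f p)\<^sup>2)"
  unfolding power2_eq_square by (rule adm_mult)

lemma adm_sum: "(\<And>i. i \<in> I \<Longrightarrow> adm R L (f i)) \<Longrightarrow> I \<noteq> {} \<Longrightarrow> finite I \<Longrightarrow> adm R L (\<lambda>p. \<Sum>i\<in>I. f i p)"
proof (induction I rule: infinite_finite_induct)
  case (insert i I)
  then show ?case by (cases "I = {}") (simp_all add: adm_add)
qed simp_all

lemma adm_borel: "adm R L f \<Longrightarrow> f \<in> borel_measurable borel"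
  by (simp add: adm_def borel_measurable_continuous_onI)

lemma adm_shift:
  assumes "adm R L f"
  shows "adm R L (\<lambda>p. f (p + ((0, 0), h)))"
proof -
  have "continuous_on UNIV (\<lambda>p. f (p + ((0, 0), h)))"
    by (rule continuous_on_compose2[OF adm_continuous[OF assms]]) (auto intro!: continuous_intros)
  have "f (x, z + L + h) = f (x, z + h)" for x z
    using adm_periodic[OF assms, of x "z + h"] by (simp add: ac_simps)
  moreover obtain r where "r < R" "\<And>x z. r \<le> norm x \<Longrightarrow> f (x, z) = 0"
    using assms by (rule adm_support) blast
  ultimately show ?thesis
    using \<open>continuous_on UNIV (\<lambda>p. f (p + ((0, 0), h)))\<close>
    by (intro admI[where r = r]) (simp_all add: add_zero_pair)
qed

lemma adm_periodic_int:
  assumes "adm R L f"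
  shows "f (x, z + of_int k * L) = f (x, z)"
proof -
  have nat: "f (x, z + real n * L) = f (x, z)" for n z
  proof (induction n)
    case (Suc n)
    have "f (x, z + real (Suc n) * L) = f (x, (z + real n * L) + L)"
      by (simp add: algebra_simps)
    also have "\<dots> = f (x, z + real n * L)"
      by (rule adm_periodic[OF assms])
    finally show ?case using Suc by simp
  qed simp
  show ?thesis
  proof (cases "0 \<le> k")
    case True
    then show ?thesis using nat[of z "nat k"] by simp
  next
    case False
    then show ?thesis using nat[of "z + of_int k * L" "nat (- k)"] by simp
  qed
qed

lemma adm_fundamental_domain:
  assumes f: "adm R L f" and L: "0 < L"
  obtains z' where "z' \<in> {0..L}" "f (x, z') = f (x, z)"
proof
  define k where "k = \<lfloor>z / L\<rfloor>"
  have "of_int k * L \<le> z" "z < (of_int k + 1) * L"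
    using L by (simp_all add: k_def pos_le_divide_eq[symmetric] pos_divide_less_eq[symmetric])
  then show "z + of_int (- k) * L \<in> {0..L}" by (simp add: algebra_simps)
  show "f (x, z + of_int (- k) * L) = f (x, z)" by (rule adm_periodic_int[OF f])
qed

text \<open>Periodicity moves \<open>z\<close> into \<open>{0..L}\<close>, the function vanishes
  outside the disc, and the remaining closed cylinder is compact.\<close>

lemma adm_bounded:
  assumes f: "adm R L f" and L: "0 < L"
  obtains C where "0 \<le> C" "\<And>p. \<bar>f p\<bar> \<le> C"
proof -
  have "compact (f ` (cball 0 R \<times> {0..L}))"
    by (intro compact_continuous_image compact_Times compact_cball compact_Icc)
      (rule continuous_on_subset[OF adm_continuous[OF f]], simp)
  then obtain C where C: "\<And>y. y \<in> f ` (cball 0 R \<times> {0..L}) \<Longrightarrow> norm y \<le> C"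
    by (metis bounded_iff compact_imp_bounded)
  have "\<bar>f p\<bar> \<le> max 0 C" for p
  proof (cases p)
    case (Pair x z)
    obtain z' where z': "z' \<in> {0..L}" "f (x, z') = f (x, z)"
      using adm_fundamental_domain[OF f L] by blast
    show ?thesis
    proof (cases "norm x \<le> R")
      case True
      then have "\<bar>f (x, z')\<bar> \<le> C"
        using C[OF imageI, of "(x, z')"] z'(1) by simp
      then show ?thesis using z'(2) Pair by simp
    next
      case False
      moreover obtain r where "r < R" "\<And>x z. r \<le> norm x \<Longrightarrow> f (x, z) = 0"
        using f by (rule adm_support) blast
      ultimately show ?thesis using Pair by simp
    qed
  qed
  then show ?thesis using that[of "max 0 C"] by simp
qed

lemma adm_integrable:
  assumes f: "adm R L f" and L: "0 < L"
  shows "integrable (MX R L) f"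
proof -
  interpret finite_measure "MX R L" by (rule finite_measure_MX)
  obtain C where "\<And>p. \<bar>f p\<bar> \<le> C" using adm_bounded[OF f L] by metis
  then show ?thesis
    by (intro integrable_const_bound[where B = C] measurable_MX adm_borel[OF f] AE_I2) simp
qed

text \<open>This links the two descriptions of a rotation: \<open>Tz\<close> for the limits, which
  live on the fundamental domain only, and plain translation for the periodic approximants, to which
  calculus applies.\<close>

lemma adm_Tz:
  assumes "adm R L f"
  shows "f (Tz L h p) = f (p + ((0, 0), h))"
proof -
  have "f (x, z + (h - L)) = f (x, z + h)" for x z
    using adm_periodic_int[OF assms, of x "z + h" "-1"] by (simp add: algebra_simps)
  then show ?thesis
    by (cases p) (simp add: Tz_def add_zero_pair)
qed

section \<open>Directional derivatives and their periodicity and support\<close>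

lemma has_dd_unique: "has_dd b f f1 \<Longrightarrow> has_dd b f f2 \<Longrightarrow> f1 = f2"
proof
  fix p assume "has_dd b f f1" "has_dd b f f2"
  then have "((\<lambda>t. f (p + t *\<^sub>R b)) has_real_derivative f1 (p + 0 *\<^sub>R b)) (at 0)"
    "((\<lambda>t. f (p + t *\<^sub>R b)) has_real_derivative f2 (p + 0 *\<^sub>R b)) (at 0)"
    unfolding has_dd_def by blast+
  then show "f1 p = f2 p" using DERIV_unique by fastforce
qed

lemma has_dd_shift: "has_dd b f f' \<Longrightarrow> has_dd b (\<lambda>p. f (p + c)) (\<lambda>p. f' (p + c))"
  unfolding has_dd_def
proof (intro allI)
  fix p t
  assume *: "\<forall>p t. ((\<lambda>t. f (p + t *\<^sub>R b)) has_real_derivative f' (p + t *\<^sub>R b)) (at t)"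
  show "((\<lambda>t. f (p + t *\<^sub>R b + c)) has_real_derivative f' (p + t *\<^sub>R b + c)) (at t)"
    using *[rule_format, of "p + c" t] by (simp add: add.assoc add.commute[of _ c])
qed

lemma has_dd_diff: "has_dd b f f' \<Longrightarrow> has_dd b g g' \<Longrightarrow> has_dd b (\<lambda>p. f p - g p) (\<lambda>p. f' p - g' p)"
  unfolding has_dd_def by (intro allI DERIV_diff) blast+

lemma has_dd_mult: "has_dd b f f' \<Longrightarrow> has_dd b g g' \<Longrightarrow> has_dd b (\<lambda>p. f p * g p) (\<lambda>p. f' p * g p + g' p * f p)"
  unfolding has_dd_def by (intro allI DERIV_mult) blast+

lemma has_dd_differentiable:
  assumes "f differentiable_on UNIV"
  shows "has_dd b f (Dir f b)"
  unfolding has_dd_def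
proof (intro allI)
  fix p :: 'a and t
  have "f differentiable (at (p + t *\<^sub>R b))"
    using assms by (simp add: differentiable_on_def)
  then have f: "(f has_derivative frechet_derivative f (at (p + t *\<^sub>R b))) (at (p + t *\<^sub>R b))"
    by (simp add: frechet_derivative_works)
  have "((\<lambda>t. p + t *\<^sub>R b) has_derivative (\<lambda>s. s *\<^sub>R b)) (at t)"
    by (auto intro!: derivative_eq_intros)
  from diff_chain_at[OF this f]
  have "((\<lambda>t. f (p + t *\<^sub>R b)) has_derivative (\<lambda>s. frechet_derivative f (at (p + t *\<^sub>R b)) (s *\<^sub>R b))) (at t)"
    by (simp add: o_def)
  then show "((\<lambda>t. f (p + t *\<^sub>R b)) has_real_derivative Dir f b (p + t *\<^sub>R b)) (at t)"
    unfolding has_field_derivative_def Dir_def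
    by (rule back_subst[where P="\<lambda>F. (_ has_derivative F) _"])
      (auto simp: linear_cmul[OF has_derivative_linear[OF f]])
qed

text \<open>Periodicity passes to \<open>f'\<close> because the translate of \<open>f'\<close> is a
  derivative of the same function \<open>f\<close>. Vanishing passes to \<open>f'\<close> where
  \<open>f\<close> vanishes along a whole segment around the point.\<close>

lemma adm_has_dd:
  assumes f: "adm R L f" and dd: "has_dd b f f'" and cont: "continuous_on UNIV f'"
  shows "adm R L f'"
proof -
  obtain r where r: "r < R" "\<And>x z. r \<le> norm x \<Longrightarrow> f (x, z) = 0"
    using f by (rule adm_support) blast
  \<comment> \<open>The support radius grows to the midpoint of \<open>r\<close> and
    \<open>R\<close>: such points satisfy \<open>r < norm x\<close> strictly, hence so do nearby
    points on the line.\<close>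
  have "f' (x, z) = 0" if "(r + R) / 2 \<le> norm x" for x z
  proof -
    have "((\<lambda>t. norm (x + t *\<^sub>R fst b)) \<longlongrightarrow> norm (x + 0 *\<^sub>R fst b)) (at 0)"
      by (intro tendsto_intros)
    moreover have "r < norm (x + 0 *\<^sub>R fst b)" using that r(1) by (simp add: field_simps)
    ultimately have "eventually (\<lambda>t. r < norm (x + t *\<^sub>R fst b)) (at 0)"
      by (rule order_tendstoD)
    then have "eventually (\<lambda>t. f ((x, z) + t *\<^sub>R b) = 0) (at 0)"
      by eventually_elim (auto simp: plus_prod_def scaleR_prod_def intro: r(2))
    moreover have "f ((x, z) + 0 *\<^sub>R b) = 0" using that r by (simp add: field_simps)
    ultimately have "eventually (\<lambda>t. f ((x, z) + t *\<^sub>R b) = 0) (nhds 0)"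
      by (auto simp: eventually_at_filter elim: eventually_mono)
    moreover have "((\<lambda>t. f ((x, z) + t *\<^sub>R b)) has_real_derivative f' ((x, z) + 0 *\<^sub>R b)) (at 0)"
      using dd unfolding has_dd_def by blast
    ultimately have "((\<lambda>t. 0) has_real_derivative f' ((x, z) + 0 *\<^sub>R b)) (at 0)"
      by (subst (asm) DERIV_cong_ev[OF refl _ refl])
    then show ?thesis using DERIV_unique[OF _ DERIV_const] by fastforce
  qed
  moreover have "(r + R) / 2 < R" using r(1) by simp
  moreover have "f' (x, z + L) = f' (x, z)" for x z
  proof -
    have per: "(\<lambda>p. f (p + ((0, 0), L))) = f"
    proof
      fix p
      show "f (p + ((0, 0), L)) = f p"
        by (cases p) (simp add: add_zero_pair adm_periodic[OF f])
    qed
    have "has_dd b f (\<lambda>p. f' (p + ((0, 0), L)))"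
      using has_dd_shift[OF dd, of "((0, 0), L)"] unfolding per .
    from has_dd_unique[OF this dd] have "f' ((x, z) + ((0, 0), L)) = f' (x, z)" by metis
    then show ?thesis by (simp add: add_zero_pair)
  qed
  ultimately show ?thesis using cont by (intro admI[where r = "(r + R) / 2"]) blast+
qed

lemma test_fun_adm: "test_fun R L f \<Longrightarrow> adm R L f"
  unfolding test_fun_def adm_def smooth_fun_def
  using Ck.simps(1) by blast

lemma smooth_fun_Dir: "smooth_fun f \<Longrightarrow> smooth_fun (Dir f b)"
  unfolding smooth_fun_def Dir_def[abs_def] using Ck.simps(2) by blast

lemma smooth_fun_has_dd: "smooth_fun f \<Longrightarrow> has_dd b f (Dir f b)"
  by (rule has_dd_differentiable) (metis smooth_fun_def Ck.simps(2))

lemma smooth_fun_continuous: "smooth_fun f \<Longrightarrow> continuous_on UNIV f"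
  unfolding smooth_fun_def using Ck.simps(1) by blast

lemma adm_Dir: "smooth_fun f \<Longrightarrow> adm R L f \<Longrightarrow> adm R L (Dir f b)"
  by (rule adm_has_dd[OF _ smooth_fun_has_dd]) (auto intro: smooth_fun_continuous smooth_fun_Dir)

section \<open>Integration by parts\<close>

lemma integral_MX:
  "(\<integral>p. g p \<partial>MX R L) = (\<integral>p. indicator (XL R L) p * g p \<partial>lborel)" for g :: "_ \<Rightarrow> real"
  by (subst integral_restrict_space) auto

lemma integral_lborel_translate:
  fixes F :: "'a::euclidean_space \<Rightarrow> real"
  assumes F: "F \<in> borel_measurable borel"
  shows "(\<integral>p. F (p + c) \<partial>lborel) = (\<integral>p. F p \<partial>lborel)"
proof -
  have "(\<integral>p. F p \<partial>lborel) = (\<integral>p. F p \<partial>distr lborel borel ((+) c))"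
    by (simp add: lborel_distr_plus)
  also have "\<dots> = (\<integral>p. F (c + p) \<partial>lborel)"
    by (rule integral_distr) (simp_all add: F)
  finally show ?thesis by (simp add: add.commute)
qed

text \<open>Translations along the circle are rotations, while those along the disc move the
  support; the two kinds need different arguments.\<close>

lemma Basis_cases:
  assumes "b \<in> (Basis :: ((real \<times> real) \<times> real) set)"
  obtains "b = zdir" | v where "b = (v, 0)" "norm v = 1"
  using assms by (auto simp: Basis_prod_def zdir_def zero_prod_def[symmetric] norm_prod_def)

text \<open>Along the circle this is rotation invariance. Along the disc a shift by at most
  \<open>R - r\<close> keeps the support inside, so the disc may be replaced by the whole plane,
  where the integral is translation invariant.\<close>

lemma integral_MX_shift:
  assumes g: "adm R L g" and r: "\<And>x z. r \<le> norm x \<Longrightarrow> g (x, z) = 0"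
    and b: "b \<in> Basis" and t: "0 \<le> t" "t \<le> L" "t \<le> R - r"
  shows "(\<integral>p. g (p + t *\<^sub>R b) \<partial>MX R L) = (\<integral>p. g p \<partial>MX R L)"
  using b
proof (cases rule: Basis_cases)
  case 1
  then have "g (p + t *\<^sub>R b) = g (Tz L t p)" for p
    using adm_Tz[OF g, of t p] by (simp add: zdir_def zero_prod_def)
  then show ?thesis
    using integral_Tz[OF adm_borel[OF g] t(1,2)] by simp
next
  case (2 v)
  \<comment> \<open>Only the cutoff in \<open>z\<close> is kept; shifts in the direction
    \<open>(v, 0)\<close> do not affect it.\<close>
  define F where "F = (\<lambda>p. indicator {p. snd p \<in> {0..<L}} p * g p)"
  have "{p :: (real \<times> real) \<times> real. snd p \<in> {0..<L}} = {p. 0 \<le> snd p} \<inter> {p. snd p < L}"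
    by auto
  then have "{p :: (real \<times> real) \<times> real. snd p \<in> {0..<L}} \<in> sets borel"
    using sets.Int[OF snd_ge_borel[of 0] snd_less_borel[of L]] by simp
  then have F: "F \<in> borel_measurable borel"
    unfolding F_def by (intro borel_measurable_times borel_measurable_indicator adm_borel[OF g])
  have F1: "indicator (XL R L) p * g p = F p" for p
  proof (cases p)
    case (Pair x z)
    then show ?thesis
      using r[of x z] t by (cases "norm x < R") (auto simp: F_def XL_def indicator_def)
  qed
  have F2: "indicator (XL R L) p * g (p + t *\<^sub>R b) = F (p + t *\<^sub>R b)" for p
  proof (cases p)
    case (Pair x z)
    show ?thesis
    proof (cases "norm x < R")
      case True
      then show ?thesis
        using Pair 2 by (auto simp: F_def XL_def indicator_def)
    next
      case False
      have "norm x \<le> norm (x + t *\<^sub>R v) + norm (t *\<^sub>R v)"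
        using norm_triangle_ineq4[of "x + t *\<^sub>R v" "t *\<^sub>R v"] by simp
      then have "r \<le> norm (x + t *\<^sub>R v)" using False t 2 by simp
      then show ?thesis
        using Pair 2 r[of "x + t *\<^sub>R v" z] by (simp add: F_def)
    qed
  qed
  show ?thesis
    unfolding integral_MX F1 F2 by (rule integral_lborel_translate[OF F])
qed

text \<open>Translation invariance makes the integral of every difference quotient vanish; dominated
  convergence passes to the derivative.\<close>
lemma integral_has_dd:
  assumes g: "adm R L g" "adm R L g'" and dd: "has_dd b g g'" and b: "b \<in> Basis" and L: "0 < L"
  shows "(\<integral>p. g' p \<partial>MX R L) = 0"
proof -
  obtain r where r: "r < R" "\<And>x z. r \<le> norm x \<Longrightarrow> g (x, z) = 0"
    using g(1) by (rule adm_support) blast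
  obtain C where C: "0 \<le> C" "\<And>p. \<bar>g' p\<bar> \<le> C" using adm_bounded[OF g(2) L] by blast
  interpret finite_measure "MX R L" by (rule finite_measure_MX)
  \<comment> \<open>Admissible shift lengths are bounded by one turn of the circle and by the margin
    between the support and the boundary.\<close>
  define \<delta> where "\<delta> = min L (R - r)"
  define t where "t n = \<delta> / real (Suc n)" for n
  have "0 < \<delta>" using r(1) L by (simp add: \<delta>_def)
  then have t: "0 < t n" "t n \<le> \<delta>" for n
    by (auto simp: t_def divide_le_eq)
  have "t \<longlonglongrightarrow> 0"
    using tendsto_mult[OF tendsto_const[of \<delta>] LIMSEQ_inverse_real_of_nat] by (simp add: t_def[abs_def] divide_inverse)
  define s where "s n p = (g (p + t n *\<^sub>R b) - g p) / t n" for n p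
  have cont: "continuous_on UNIV (\<lambda>p. g (p + c))" for c
    by (rule continuous_on_compose2[OF adm_continuous[OF g(1)]]) (auto intro!: continuous_intros)
  have s: "s n \<in> borel_measurable borel" for n
    unfolding s_def by (intro borel_measurable_continuous_onI continuous_intros cont adm_continuous[OF g(1)])
      (use t(1)[of n] in simp)
  have lim: "(\<lambda>n. s n p) \<longlonglongrightarrow> g' p" for p
  proof -
    have "((\<lambda>t. g (p + t *\<^sub>R b)) has_real_derivative g' (p + 0 *\<^sub>R b)) (at 0)"
      using dd unfolding has_dd_def by blast
    then have "((\<lambda>h. (g (p + h *\<^sub>R b) - g p) / h) \<longlongrightarrow> g' p) (at 0)"
      by (simp add: DERIV_def)
    moreover have "filterlim t (at 0) sequentially"
      using \<open>t \<longlonglongrightarrow> 0\<close> t(1) by (auto simp: filterlim_at less_imp_neq[symmetric] intro!: always_eventually)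
    ultimately show ?thesis
      unfolding s_def by (rule filterlim_compose)
  qed
  \<comment> \<open>The mean value theorem turns each difference quotient into a value of
    \<open>g'\<close>, which gives a constant dominating function.\<close>
  have bound: "\<bar>s n p\<bar> \<le> C" for n p
  proof -
    have "\<exists>z. z > 0 \<and> z < t n \<and> g (p + t n *\<^sub>R b) - g (p + 0 *\<^sub>R b) = (t n - 0) * g' (p + z *\<^sub>R b)"
      using dd unfolding has_dd_def by (intro MVT2[OF t(1)]) blast
    then obtain z where "g (p + t n *\<^sub>R b) - g p = t n * g' (p + z *\<^sub>R b)" by auto
    then have "s n p = g' (p + z *\<^sub>R b)" using t(1)[of n] by (simp add: s_def)
    then show ?thesis using C(2) by simp
  qed
  have "(\<lambda>n. \<integral>p. s n p \<partial>MX R L) \<longlonglongrightarrow> (\<integral>p. g' p \<partial>MX R L)"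
  proof (rule integral_dominated_convergence[where w = "\<lambda>_. C"])
    show "integrable (MX R L) (\<lambda>_. C)" by simp
    show "AE p in MX R L. (\<lambda>n. s n p) \<longlonglongrightarrow> g' p" using lim by simp
    show "AE p in MX R L. norm (s n p) \<le> C" for n using bound by simp
    show "s n \<in> borel_measurable (MX R L)" for n by (rule measurable_MX[OF s])
    show "g' \<in> borel_measurable (MX R L)" by (rule measurable_MX[OF adm_borel[OF g(2)]])
  qed
  moreover have "(\<integral>p. s n p \<partial>MX R L) = 0" for n
  proof -
    have int: "integrable (MX R L) g" by (rule adm_integrable[OF g(1) L])
    obtain C where C: "\<And>p. \<bar>g p\<bar> \<le> C" using adm_bounded[OF g(1) L] by blast
    have "integrable (MX R L) (\<lambda>p. g (p + t n *\<^sub>R b))"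
      by (rule integrable_const_bound[where B = C])
        (auto simp: C intro!: measurable_MX borel_measurable_continuous_onI cont)
    then have "(\<integral>p. s n p \<partial>MX R L) = ((\<integral>p. g (p + t n *\<^sub>R b) \<partial>MX R L) - (\<integral>p. g p \<partial>MX R L)) / t n"
      using int unfolding s_def by simp
    also have "(\<integral>p. g (p + t n *\<^sub>R b) \<partial>MX R L) = (\<integral>p. g p \<partial>MX R L)"
      using t[of n] by (intro integral_MX_shift[OF g(1) r(2) b]) (auto simp: \<delta>_def)
    finally show ?thesis by simp
  qed
  ultimately show ?thesis by (simp add: LIMSEQ_const_iff)
qed

text \<open>The derivative of \<open>u * u'\<close> is \<open>u' * u' + u'' * u\<close>, and its
  integral vanishes by \<open>integral_has_dd\<close>.\<close>

lemma integral_by_parts: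
  assumes adm: "adm R L u" "adm R L u'" "adm R L u''" and dd: "has_dd b u u'" "has_dd b u' u''"
    and b: "b \<in> Basis" and L: "0 < L"
  shows "(\<integral>p. u p * u'' p \<partial>MX R L) = - (\<integral>p. (u' p)\<^sup>2 \<partial>MX R L)"
proof -
  have "(\<integral>p. u' p * u' p + u'' p * u p \<partial>MX R L) = 0"
    by (intro integral_has_dd[OF _ _ has_dd_mult[OF dd] b L] adm_add adm_mult adm)
  moreover have "(\<integral>p. u' p * u' p + u'' p * u p \<partial>MX R L) =
      (\<integral>p. u' p * u' p \<partial>MX R L) + (\<integral>p. u'' p * u p \<partial>MX R L)"
    by (intro Bochner_Integration.integral_add adm_integrable[OF _ L] adm_mult adm)
  ultimately show ?thesis by (simp add: power2_eq_square mult.commute)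
qed

section \<open>Inequalities on circles\<close>

text \<open>Integrating over an interval longer by 1 at both ends makes \<open>a\<close> and
  \<open>b\<close> interior points, so the derivative there is two-sided.\<close>

lemma has_antiderivative_at:
  fixes f :: "real \<Rightarrow> real"
  assumes "continuous_on UNIV f"
  obtains S where "\<And>t. t \<in> {a..b} \<Longrightarrow> (S has_real_derivative f t) (at t)"
proof -
  obtain S where S: "\<And>t. t \<in> {a-1..b+1} \<Longrightarrow> (S has_vector_derivative f t) (at t within {a-1..b+1})"
    using antiderivative_continuous[of "a-1" "b+1" f] assms continuous_on_subset by blast
  have "(S has_real_derivative f t) (at t)" if "t \<in> {a..b}" for t
  proof -
    have "at t within {a-1..b+1} = at t"
      using that by (intro at_within_interior) auto
    then show ?thesis
      using S[of t] that by (simp add: has_real_derivative_iff_has_vector_derivative)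
  qed
  then show ?thesis using that by blast
qed

text \<open>With \<open>S\<close> an antiderivative of \<open>w\<^sup>2\<close>, the function \<open>S - 2 I u + I\<^sup>2 t\<close> has derivative
  \<open>(w - I)\<^sup>2\<close>; choosing for \<open>I\<close> the mean slope of \<open>u\<close> yields the estimate.\<close>
lemma square_increment_le:
  fixes u w :: "real \<Rightarrow> real"
  assumes u: "\<And>t. (u has_real_derivative w t) (at t)" and w: "continuous_on UNIV w"
    and y: "y \<in> {0..L}" and z: "z \<in> {0..L}"
  shows "ennreal ((u z - u y)\<^sup>2) \<le> ennreal L * (\<integral>\<^sup>+t. ennreal ((w t)\<^sup>2) * indicator {0..L} t \<partial>lborel)"
proof -
  have w2: "continuous_on UNIV (\<lambda>t. (w t)\<^sup>2)" by (intro continuous_intros w)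
  obtain S where S: "\<And>t. t \<in> {0..L} \<Longrightarrow> (S has_real_derivative (w t)\<^sup>2) (at t)"
    using has_antiderivative_at[OF w2] by blast
  have mono: "S a \<le> S b" if "a \<in> {0..L}" "b \<in> {0..L}" "a \<le> b" for a b
  proof (rule DERIV_nonneg_imp_nondecreasing[OF that(3)])
    fix t assume "a \<le> t" "t \<le> b"
    then show "\<exists>y. (S has_real_derivative y) (at t) \<and> 0 \<le> y"
      using S[of t] that by (intro exI[of _ "(w t)\<^sup>2"]) auto
  qed
  \<comment> \<open>The points are ordered strictly since the mean slope \<open>I\<close> divides by
    \<open>b - a\<close>; the symmetry of the square covers the other order at the end.\<close>
  have *: "(u b - u a)\<^sup>2 \<le> L * (S L - S 0)" if ab: "a \<in> {0..L}" "b \<in> {0..L}" "a < b" for a b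
  proof -
    define I where "I = (u b - u a) / (b - a)"
    have I: "I * (b - a) = u b - u a" using ab by (simp add: I_def)
    define Q where "Q t = S t - 2 * I * u t + I\<^sup>2 * t" for t
    have "Q a \<le> Q b"
    proof (rule DERIV_nonneg_imp_nondecreasing[OF less_imp_le[OF ab(3)]])
      fix t assume t: "a \<le> t" "t \<le> b"
      have "(Q has_real_derivative ((w t)\<^sup>2 - 2 * I * w t + I\<^sup>2)) (at t)"
        unfolding Q_def using t ab by (auto intro!: derivative_eq_intros S u)
      moreover have "(w t)\<^sup>2 - 2 * I * w t + I\<^sup>2 = (w t - I)\<^sup>2" by (simp add: power2_diff)
      ultimately show "\<exists>y. (Q has_real_derivative y) (at t) \<and> 0 \<le> y"
        by (metis zero_le_power2)
    qed
    then have "S a - 2 * I * u a + I\<^sup>2 * a \<le> S b - 2 * I * u b + I\<^sup>2 * b" by (simp add: Q_def)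
    then have "2 * I * (u b - u a) - I * (I * (b - a)) \<le> S b - S a"
      by (simp add: algebra_simps power2_eq_square)
    then have "I * (u b - u a) \<le> S b - S a" unfolding I by simp
    then have "(b - a) * (I * (u b - u a)) \<le> (b - a) * (S b - S a)"
      using ab by (intro mult_left_mono) auto
    also have "(b - a) * (I * (u b - u a)) = (u b - u a)\<^sup>2"
      using I by (simp add: power2_eq_square mult.assoc[symmetric] mult.commute)
    also have "(b - a) * (S b - S a) \<le> L * (S L - S 0)"
      using ab mono[of b L] mono[of 0 a] mono[of a b] by (intro mult_mono) auto
    finally show ?thesis .
  qed
  have L0: "0 \<le> L" using y by simp
  have "(\<integral>\<^sup>+t. ennreal ((w t)\<^sup>2) * indicator {0..L} t \<partial>lborel) = ennreal (S L - S 0)"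
    by (rule nn_integral_FTC_Icc) (use L0 S borel_measurable_continuous_onI[OF w2] in auto)
  moreover have "(u z - u y)\<^sup>2 \<le> L * (S L - S 0)"
    using *[of y z] *[of z y] y z mono[of 0 L] L0 by (cases y z rule: linorder_cases) (auto simp: power2_commute)
  ultimately show ?thesis
    using L0 by (simp add: ennreal_mult'[symmetric] ennreal_leI)
qed

text \<open>The cross term \<open>2 d(z) d(z + h)\<close> integrates to zero over a period.\<close>
lemma mean_zero_le:
  fixes f d :: "real \<Rightarrow> real"
  assumes f: "\<And>t. (f has_real_derivative d t) (at t)" and d: "continuous_on UNIV d"
    and per: "f L = f 0" and L: "0 \<le> L"
  shows "ennreal (L * (d 0)\<^sup>2) \<le> (\<integral>\<^sup>+h. ennreal ((d h - d 0)\<^sup>2) * indicator {0..L} h \<partial>lborel)"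
proof -
  have d2: "continuous_on UNIV (\<lambda>t. (d t)\<^sup>2)" by (intro continuous_intros d)
  obtain S where S: "\<And>t. t \<in> {0..L} \<Longrightarrow> (S has_real_derivative (d t)\<^sup>2) (at t)"
    using has_antiderivative_at[OF d2] by blast
  define Q where "Q t = S t - 2 * d 0 * f t + (d 0)\<^sup>2 * t" for t
  have Q: "(Q has_real_derivative ((d t - d 0)\<^sup>2)) (at t)" if "t \<in> {0..L}" for t
    unfolding Q_def using that by (auto intro!: derivative_eq_intros S f simp: power2_diff)
  have "S 0 \<le> S L"
  proof (rule DERIV_nonneg_imp_nondecreasing[OF L])
    fix t assume "0 \<le> t" "t \<le> L"
    then show "\<exists>y. (S has_real_derivative y) (at t) \<and> 0 \<le> y"
      using S[of t] by (intro exI[of _ "(d t)\<^sup>2"]) auto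
  qed
  \<comment> \<open>\<open>f L = f 0\<close> cancels the cross term in \<open>Q L - Q 0\<close>, and
    the nonnegative \<open>S L - S 0\<close> is dropped.\<close>
  then have "L * (d 0)\<^sup>2 \<le> Q L - Q 0" using per by (simp add: Q_def mult.commute)
  moreover have "(\<integral>\<^sup>+h. ennreal ((d h - d 0)\<^sup>2) * indicator {0..L} h \<partial>lborel) = ennreal (Q L - Q 0)"
    by (rule nn_integral_FTC_Icc)
      (use L Q in \<open>auto intro!: borel_measurable_continuous_onI continuous_intros d\<close>)
  ultimately show ?thesis by (simp add: ennreal_leI)
qed

text \<open>Tonelli, with the half-open interval closed up at the null point \<open>L\<close> to
  match the fundamental theorem of calculus on \<open>{0..L}\<close>.\<close>

lemma nn_integral_MX_iterated:
  assumes F: "F \<in> borel_measurable borel"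
  shows "(\<integral>\<^sup>+p. F p \<partial>MX R L) =
    (\<integral>\<^sup>+x. (\<integral>\<^sup>+z. F (x, z) * indicator {0..L} z \<partial>lborel) * indicator (ball 0 R) x \<partial>lborel)"
proof -
  have meas: "(\<lambda>p. F p * indicator (XL R L) p) \<in> borel_measurable (lborel \<Otimes>\<^sub>M lborel)"
    unfolding lborel_prod
    using borel_measurable_times_ennreal[OF F borel_measurable_indicator[OF XL_borel]] by simp
  have "(\<integral>\<^sup>+p. F p \<partial>MX R L) = (\<integral>\<^sup>+p. F p * indicator (XL R L) p \<partial>(lborel \<Otimes>\<^sub>M lborel))"
    unfolding nn_integral_MX lborel_prod ..
  also have "\<dots> = (\<integral>\<^sup>+x. \<integral>\<^sup>+z. F (x, z) * indicator (XL R L) (x, z) \<partial>lborel \<partial>lborel)"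
    by (rule lborel.nn_integral_fst[OF meas, symmetric])
  also have "\<dots> = (\<integral>\<^sup>+x. (\<integral>\<^sup>+z. F (x, z) * indicator {0..L} z \<partial>lborel) * indicator (ball 0 R) x \<partial>lborel)"
  proof (rule nn_integral_cong)
    fix x
    have "(\<integral>\<^sup>+z. F (x, z) * indicator (XL R L) (x, z) \<partial>lborel) =
      (\<integral>\<^sup>+z. F (x, z) * indicator {0..L} z * indicator (ball 0 R) x \<partial>lborel)"
    proof (rule nn_integral_cong_AE)
      show "AE z in lborel. F (x, z) * indicator (XL R L) (x, z) = F (x, z) * indicator {0..L} z * indicator (ball 0 R) x"
        using AE_lborel_singleton[of L]
        by (rule AE_mp) (auto intro!: AE_I2 simp: XL_def indicator_def)
    qed
    also have "\<dots> = (\<integral>\<^sup>+z. F (x, z) * indicator {0..L} z \<partial>lborel) * indicator (ball 0 R) x"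
      by (cases "x \<in> ball 0 R") simp_all
    finally show "(\<integral>\<^sup>+z. F (x, z) * indicator (XL R L) (x, z) \<partial>lborel) =
      (\<integral>\<^sup>+z. F (x, z) * indicator {0..L} z \<partial>lborel) * indicator (ball 0 R) x" .
  qed
  finally show ?thesis .
qed

lemma has_dd_zdir:
  assumes "has_dd zdir f f'"
  shows "((\<lambda>z. f (x, z)) has_real_derivative f' (x, z)) (at z)"
proof -
  have "((\<lambda>t. f ((x, 0) + t *\<^sub>R zdir)) has_real_derivative f' ((x, 0) + z *\<^sub>R zdir)) (at z)"
    using assms unfolding has_dd_def by blast
  then show ?thesis by (simp add: zdir_def add_zero_pair)
qed

lemma continuous_slice:
  "continuous_on UNIV f \<Longrightarrow> continuous_on UNIV (\<lambda>z. f (x, z))"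
  by (rule continuous_on_compose2[of UNIV f]) (auto intro!: continuous_intros)

text \<open>Comparing with the zero on the circle over \<open>x\<close>,
  \<open>square_increment_le\<close> bounds the square of \<open>u\<close> there by
  \<open>L * W x\<close>. Integrating over the circle gives the second factor \<open>L\<close>, and
  then the disc is integrated out.\<close>

lemma poincare_MX:
  assumes u: "adm R L u" and w: "adm R L w" and dd: "has_dd zdir u w" and L: "0 < L"
    and zero: "\<And>x. \<exists>y\<in>{0..L}. u (x, y) = 0"
  shows "(\<integral>\<^sup>+p. ennreal ((u p)\<^sup>2) \<partial>MX R L) \<le> ennreal (L\<^sup>2) * (\<integral>\<^sup>+p. ennreal ((w p)\<^sup>2) \<partial>MX R L)"
proof -
  have meas: "(\<lambda>p. ennreal ((f p)\<^sup>2)) \<in> borel_measurable borel" if "adm R L f" for f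
    by (intro measurable_compose[OF _ measurable_ennreal] adm_borel[OF adm_power2[OF that]])
  define W where "W x = (\<integral>\<^sup>+z. ennreal ((w (x, z))\<^sup>2) * indicator {0..L} z \<partial>lborel)" for x
  have inner: "(\<integral>\<^sup>+z. ennreal ((u (x, z))\<^sup>2) * indicator {0..L} z \<partial>lborel) \<le> ennreal (L\<^sup>2) * W x" for x
  proof -
    obtain y where y: "y \<in> {0..L}" "u (x, y) = 0" using zero by blast
    have "ennreal ((u (x, z))\<^sup>2) \<le> ennreal L * W x" if "z \<in> {0..L}" for z
      using square_increment_le[OF has_dd_zdir[OF dd] continuous_slice[OF adm_continuous[OF w]] y(1) that, of x] y(2)
      by (simp add: W_def)
    then have "(\<integral>\<^sup>+z. ennreal ((u (x, z))\<^sup>2) * indicator {0..L} z \<partial>lborel)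
        \<le> (\<integral>\<^sup>+z. ennreal L * W x * indicator {0..L} z \<partial>lborel)"
      by (intro nn_integral_mono) (simp add: indicator_def)
    also have "\<dots> = ennreal L * W x * ennreal L"
      using L by (simp add: nn_integral_cmult_indicator)
    also have "\<dots> = ennreal (L\<^sup>2) * W x"
      using L by (simp add: power2_eq_square ennreal_mult mult_ac)
    finally show ?thesis .
  qed
  have Wmeas: "W \<in> borel_measurable borel"
  proof -
    have "(\<lambda>p. ennreal ((w p)\<^sup>2) * indicator (snd -` {0..L}) p) \<in> borel_measurable borel"
      by (intro borel_measurable_times_ennreal meas w borel_measurable_indicator borel_closed
          closed_vimage_snd closed_real_atLeastAtMost)
    then have "(\<lambda>p. ennreal ((w p)\<^sup>2) * indicator (snd -` {0..L}) p) \<in> borel_measurable (lborel \<Otimes>\<^sub>M lborel)"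
      by (simp add: lborel_prod)
    from lborel.borel_measurable_nn_integral_fst[OF this] show ?thesis
      by (simp add: W_def[abs_def] indicator_def)
  qed
  have "(\<integral>\<^sup>+p. ennreal ((u p)\<^sup>2) \<partial>MX R L) \<le> (\<integral>\<^sup>+x. ennreal (L\<^sup>2) * (W x * indicator (ball 0 R) x) \<partial>lborel)"
    unfolding nn_integral_MX_iterated[OF meas[OF u]]
    by (intro nn_integral_mono) (use inner in \<open>simp add: indicator_def\<close>)
  also have "\<dots> = ennreal (L\<^sup>2) * (\<integral>\<^sup>+x. W x * indicator (ball 0 R) x \<partial>lborel)"
    by (intro nn_integral_cmult) (simp add: Wmeas borel_measurable_times_ennreal borel_measurable_indicator)
  also have "(\<integral>\<^sup>+x. W x * indicator (ball 0 R) x \<partial>lborel) = (\<integral>\<^sup>+p. ennreal ((w p)\<^sup>2) \<partial>MX R L)"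
    unfolding nn_integral_MX_iterated[OF meas[OF w]] W_def ..
  finally show ?thesis .
qed

text \<open>On a circle the increment is nonnegative at a minimum of \<open>f\<close> and
  nonpositive at a maximum, so the intermediate value theorem applies, in two forms according to the
  order of \<open>m\<close> and \<open>M\<close>.\<close>

lemma adm_increment_zero:
  assumes f: "adm R L f" and L: "0 < L"
  shows "\<exists>y\<in>{0..L}. f ((x, y) + ((0, 0), h)) - f (x, y) = 0"
proof -
  have cont: "continuous_on UNIV (\<lambda>z. f (x, z))"
    by (rule continuous_slice[OF adm_continuous[OF f]])
  then have cont': "continuous_on {0..L} (\<lambda>z. f (x, z))"
    by (rule continuous_on_subset) simp
  have "{0..L} \<noteq> {}" using L by simp
  then obtain m M where m: "m \<in> {0..L}" "\<And>z. z \<in> {0..L} \<Longrightarrow> f (x, m) \<le> f (x, z)"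
    and M: "M \<in> {0..L}" "\<And>z. z \<in> {0..L} \<Longrightarrow> f (x, z) \<le> f (x, M)"
    using continuous_attains_inf[OF compact_Icc _ cont'] continuous_attains_sup[OF compact_Icc _ cont'] by metis
  \<comment> \<open>The rotated point may leave \<open>{0..L}\<close>, where extremality is known,
    and is replaced by its representative.\<close>
  have rep: "\<exists>z'\<in>{0..L}. f (x, z') = f (x, z)" for z
    using adm_fundamental_domain[OF f L] by blast
  define u where "u z = f (x, z + h) - f (x, z)" for z
  have "0 \<le> u m" "u M \<le> 0"
    using rep[of "m + h"] rep[of "M + h"] m(2) M(2) by (auto simp: u_def) metis+
  moreover have "continuous_on S u" for S
    unfolding u_def
    by (intro continuous_on_diff continuous_on_subset[OF cont] continuous_on_compose2[OF cont])
      (auto intro!: continuous_intros)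
  ultimately have "\<exists>y. (m \<le> y \<and> y \<le> M \<or> M \<le> y \<and> y \<le> m) \<and> u y = 0"
    using IVT'[of u M 0 m] IVT2'[of u M 0 m] by (metis linear)
  then obtain y where "m \<le> y \<and> y \<le> M \<or> M \<le> y \<and> y \<le> m" "u y = 0" by blast
  moreover from this(1) have "y \<in> {0..L}" using m(1) M(1) by auto
  ultimately show ?thesis by (auto simp: u_def add_zero_pair)
qed

text \<open>\<open>mean_zero_le\<close> is applied on every circle from every starting point and the
  order of integration is exchanged. A derivative along the circle whose increments are small for
  all \<open>h\<close> is therefore small itself.\<close>

lemma mean_zero_MX:
  assumes f: "adm R L f" and D: "adm R L D" and dd: "has_dd zdir f D" and L: "0 < L"
  shows "ennreal L * (\<integral>\<^sup>+p. ennreal ((D p)\<^sup>2) \<partial>MX R L) \<le>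
    (\<integral>\<^sup>+h. (\<integral>\<^sup>+p. ennreal ((D (p + ((0, 0), h)) - D p)\<^sup>2) \<partial>MX R L) * indicator {0..L} h \<partial>lborel)"
proof -
  interpret finite_measure "MX R L" by (rule finite_measure_MX)
  interpret P: pair_sigma_finite "MX R L" lborel ..
  define K where "K p h = ennreal ((D (p + ((0, 0), h)) - D p)\<^sup>2) * indicator {0..L} h" for p h
  \<comment> \<open>Exchanging the integrals requires joint measurability in \<open>(p, h)\<close>,
    which comes from joint continuity and a closed strip.\<close>
  have K: "case_prod K \<in> borel_measurable (MX R L \<Otimes>\<^sub>M lborel)"
  proof -
    have "continuous_on UNIV (\<lambda>q :: ((real \<times> real) \<times> real) \<times> real. (D (fst q + ((0, 0), snd q)) - D (fst q))\<^sup>2)"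
      by (intro continuous_intros continuous_on_compose2[OF adm_continuous[OF D]]) auto
    then have "(\<lambda>q :: ((real \<times> real) \<times> real) \<times> real. ennreal ((D (fst q + ((0, 0), snd q)) - D (fst q))\<^sup>2)) \<in> borel_measurable borel"
      by (intro measurable_compose[OF _ measurable_ennreal] borel_measurable_continuous_onI)
    moreover have "(\<lambda>q :: ((real \<times> real) \<times> real) \<times> real. indicator (snd -` {0..L}) q :: ennreal) \<in> borel_measurable borel"
      by (intro borel_measurable_indicator borel_closed closed_vimage_snd closed_real_atLeastAtMost)
    ultimately have "(\<lambda>q. ennreal ((D (fst q + ((0, 0), snd q)) - D (fst q))\<^sup>2) * indicator (snd -` {0..L}) q)
        \<in> borel_measurable (borel \<Otimes>\<^sub>M borel)"
      unfolding borel_prod by (rule borel_measurable_times_ennreal)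
    moreover have "(\<lambda>q. q) \<in> MX R L \<Otimes>\<^sub>M lborel \<rightarrow>\<^sub>M borel \<Otimes>\<^sub>M borel"
    proof -
      have "(\<lambda>q. (fst q, snd q)) \<in> MX R L \<Otimes>\<^sub>M lborel \<rightarrow>\<^sub>M borel \<Otimes>\<^sub>M borel"
        by (intro measurable_Pair measurable_compose[OF measurable_fst] measurable_compose[OF measurable_snd]
            measurable_MX measurable_ident_sets refl) simp_all
      then show ?thesis by simp
    qed
    ultimately have "(\<lambda>q. ennreal ((D (fst q + ((0, 0), snd q)) - D (fst q))\<^sup>2) * indicator (snd -` {0..L}) q)
        \<in> borel_measurable (MX R L \<Otimes>\<^sub>M lborel)"
      using measurable_compose by blast
    then show ?thesis by (simp add: K_def[abs_def] case_prod_beta' indicator_def)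
  qed
  have pt: "ennreal L * ennreal ((D p)\<^sup>2) \<le> (\<integral>\<^sup>+h. K p h \<partial>lborel)" for p
  proof (cases p)
    case (Pair x z)
    \<comment> \<open>The circle is reparametrised to start at \<open>z\<close>, so that
      \<open>d 0\<close> becomes \<open>D (x, z)\<close>.\<close>
    have "((\<lambda>t. f (x, z + t)) has_real_derivative D (x, z + t)) (at t)" for t
      using has_dd_zdir[OF has_dd_shift[OF dd, of "((0, 0), z)"], of x t]
      by (simp add: add_zero_pair add.commute)
    moreover have "continuous_on UNIV (\<lambda>t. D (x, z + t))"
      by (rule continuous_on_compose2[OF adm_continuous[OF D]]) (auto intro!: continuous_intros)
    ultimately have "ennreal (L * (D (x, z + 0))\<^sup>2) \<le>
        (\<integral>\<^sup>+h. ennreal ((D (x, z + h) - D (x, z + 0))\<^sup>2) * indicator {0..L} h \<partial>lborel)"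
      by (rule mean_zero_le) (use adm_periodic[OF f, of x z] L in auto)
    then show ?thesis
      using L Pair by (simp add: K_def add_zero_pair ennreal_mult')
  qed
  have "ennreal L * (\<integral>\<^sup>+p. ennreal ((D p)\<^sup>2) \<partial>MX R L) = (\<integral>\<^sup>+p. ennreal L * ennreal ((D p)\<^sup>2) \<partial>MX R L)"
    by (intro nn_integral_cmult[symmetric] measurable_compose[OF _ measurable_ennreal] measurable_MX
        adm_borel[OF adm_power2[OF D]])
  also have "\<dots> \<le> (\<integral>\<^sup>+p. \<integral>\<^sup>+h. K p h \<partial>lborel \<partial>MX R L)"
    by (intro nn_integral_mono pt)
  also have "\<dots> = (\<integral>\<^sup>+h. \<integral>\<^sup>+p. K p h \<partial>MX R L \<partial>lborel)"
    by (rule P.Fubini'[OF K, symmetric])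
  also have "\<dots> = (\<integral>\<^sup>+h. (\<integral>\<^sup>+p. ennreal ((D (p + ((0, 0), h)) - D p)\<^sup>2) \<partial>MX R L) * indicator {0..L} h \<partial>lborel)"
    by (intro nn_integral_cong) (simp add: K_def indicator_def)
  finally show ?thesis .
qed

section \<open>Square-integrable limits\<close>

text \<open>This replaces the triangle inequality of the norm throughout, at the cost of the factor
  2; it also holds for infinite integrals.\<close>

lemma nn_integral_square_add_le:
  fixes f g :: "'a \<Rightarrow> real"
  assumes f: "f \<in> borel_measurable M" and g: "g \<in> borel_measurable M"
  shows "(\<integral>\<^sup>+p. ennreal ((f p + g p)\<^sup>2) \<partial>M) \<le>
    2 * (\<integral>\<^sup>+p. ennreal ((f p)\<^sup>2) \<partial>M) + 2 * (\<integral>\<^sup>+p. ennreal ((g p)\<^sup>2) \<partial>M)"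
proof -
  have meas: "(\<lambda>p. ennreal ((h p)\<^sup>2)) \<in> borel_measurable M" if "h \<in> borel_measurable M" for h
    using that by measurable
  have "(\<integral>\<^sup>+p. ennreal ((f p + g p)\<^sup>2) \<partial>M) \<le> (\<integral>\<^sup>+p. 2 * ennreal ((f p)\<^sup>2) + 2 * ennreal ((g p)\<^sup>2) \<partial>M)"
  proof (rule nn_integral_mono)
    fix p
    have "0 \<le> (f p - g p)\<^sup>2" by simp
    then have "(f p + g p)\<^sup>2 \<le> 2 * (f p)\<^sup>2 + 2 * (g p)\<^sup>2"
      unfolding power2_sum power2_diff by linarith
    then have "ennreal ((f p + g p)\<^sup>2) \<le> ennreal (2 * (f p)\<^sup>2 + 2 * (g p)\<^sup>2)"
      by (rule ennreal_leI)
    then show "ennreal ((f p + g p)\<^sup>2) \<le> 2 * ennreal ((f p)\<^sup>2) + 2 * ennreal ((g p)\<^sup>2)"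
      by (simp add: ennreal_plus ennreal_mult)
  qed
  also have "\<dots> = 2 * (\<integral>\<^sup>+p. ennreal ((f p)\<^sup>2) \<partial>M) + 2 * (\<integral>\<^sup>+p. ennreal ((g p)\<^sup>2) \<partial>M)"
    using meas[OF f] meas[OF g] by (simp add: nn_integral_add nn_integral_cmult)
  finally show ?thesis .
qed

lemma integrable_square_iff:
  fixes f :: "'a \<Rightarrow> real"
  assumes "f \<in> borel_measurable M"
  shows "integrable M (\<lambda>p. (f p)\<^sup>2) \<longleftrightarrow> (\<integral>\<^sup>+p. ennreal ((f p)\<^sup>2) \<partial>M) < \<infinity>"
  using assms by (simp add: integrable_iff_bounded)

lemma integrable_square_add:
  fixes f g :: "'a \<Rightarrow> real"
  assumes f: "f \<in> borel_measurable M" "integrable M (\<lambda>p. (f p)\<^sup>2)"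
    and g: "g \<in> borel_measurable M" "integrable M (\<lambda>p. (g p)\<^sup>2)"
  shows "integrable M (\<lambda>p. (f p + g p)\<^sup>2)"
proof -
  have "2 * (\<integral>\<^sup>+p. ennreal ((f p)\<^sup>2) \<partial>M) + 2 * (\<integral>\<^sup>+p. ennreal ((g p)\<^sup>2) \<partial>M) < \<infinity>"
    using f g by (simp add: integrable_square_iff ennreal_mult_less_top)
  then have "(\<integral>\<^sup>+p. ennreal ((f p + g p)\<^sup>2) \<partial>M) < \<infinity>"
    using nn_integral_square_add_le[OF f(1) g(1)] by (rule order_le_less_trans[rotated])
  then show ?thesis using f g by (subst integrable_square_iff) auto
qed

text \<open>Young's inequality from expanding a square; the free weight lets a small factor be
  balanced against a merely bounded one.\<close>

lemma abs_mult_le_weighted: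
  fixes x y \<epsilon> :: real
  assumes "0 < \<epsilon>"
  shows "\<bar>x * y\<bar> \<le> \<epsilon> * x\<^sup>2 + y\<^sup>2 / \<epsilon>"
proof -
  have "0 \<le> (\<epsilon> * \<bar>x\<bar> - \<bar>y\<bar>)\<^sup>2" by simp
  then have "2 * \<epsilon> * \<bar>x * y\<bar> \<le> \<epsilon>\<^sup>2 * x\<^sup>2 + y\<^sup>2"
    by (simp add: power2_diff power_mult_distrib abs_mult mult_ac)
  moreover have "0 \<le> \<epsilon> * \<bar>x * y\<bar>" using assms by simp
  ultimately have "\<epsilon> * \<bar>x * y\<bar> \<le> \<epsilon>\<^sup>2 * x\<^sup>2 + y\<^sup>2" by linarith
  also have "\<dots> = \<epsilon> * (\<epsilon> * x\<^sup>2 + y\<^sup>2 / \<epsilon>)"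
    using assms by (simp add: field_simps power2_eq_square)
  finally show ?thesis using assms by simp
qed

lemma integrable_mult_square:
  fixes f g :: "'a \<Rightarrow> real"
  assumes f: "f \<in> borel_measurable M" "integrable M (\<lambda>p. (f p)\<^sup>2)"
    and g: "g \<in> borel_measurable M" "integrable M (\<lambda>p. (g p)\<^sup>2)"
  shows "integrable M (\<lambda>p. f p * g p)"
proof (rule Bochner_Integration.integrable_bound)
  show "integrable M (\<lambda>p. (f p)\<^sup>2 + (g p)\<^sup>2)" using f g by simp
  show "(\<lambda>p. f p * g p) \<in> borel_measurable M" using f g by simp
  show "AE p in M. norm (f p * g p) \<le> norm ((f p)\<^sup>2 + (g p)\<^sup>2)"
    using abs_mult_le_weighted[of 1] by simp
qed

text \<open>With errors \<open>x = as n - a\<close> and \<open>y = bs n - b\<close>, the difference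
  of the products is \<open>x * y + a * y + b * x\<close>, and each term is estimated by the
  weighted inequality.\<close>

lemma L2_limit_integral_mult:
  fixes a b :: "'a \<Rightarrow> real"
  assumes a: "\<And>n. as n \<in> borel_measurable M" "a \<in> borel_measurable M"
      "\<And>n. integrable M (\<lambda>p. (as n p)\<^sup>2)"
      "(\<lambda>n. \<integral>\<^sup>+p. ennreal ((as n p - a p)\<^sup>2) \<partial>M) \<longlonglongrightarrow> 0"
    and b: "\<And>n. bs n \<in> borel_measurable M" "b \<in> borel_measurable M"
      "\<And>n. integrable M (\<lambda>p. (bs n p)\<^sup>2)"
      "(\<lambda>n. \<integral>\<^sup>+p. ennreal ((bs n p - b p)\<^sup>2) \<partial>M) \<longlonglongrightarrow> 0"
  shows "(\<lambda>n. \<integral>p. as n p * bs n p \<partial>M) \<longlonglongrightarrow> (\<integral>p. a p * b p \<partial>M)"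
proof -
  \<comment> \<open>The errors are square integrable only from some index on, but one such index
    already makes the limit square integrable.\<close>
  have ev: "eventually (\<lambda>n. integrable M (\<lambda>p. (cs n p - c p)\<^sup>2)) sequentially"
    and lim: "(\<lambda>n. \<integral>p. (cs n p - c p)\<^sup>2 \<partial>M) \<longlonglongrightarrow> 0"
    and int: "integrable M (\<lambda>p. (c p)\<^sup>2)"
    if c: "\<And>n. cs n \<in> borel_measurable M" "c \<in> borel_measurable M"
      "\<And>n. integrable M (\<lambda>p. (cs n p)\<^sup>2)"
      "(\<lambda>n. \<integral>\<^sup>+p. ennreal ((cs n p - c p)\<^sup>2) \<partial>M) \<longlonglongrightarrow> 0" for cs :: "nat \<Rightarrow> 'a \<Rightarrow> real" and c
  proof -
    have "eventually (\<lambda>n. (\<integral>\<^sup>+p. ennreal ((cs n p - c p)\<^sup>2) \<partial>M) < 1) sequentially"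
      using c(4) by (rule order_tendstoD) simp
    then show ev: "eventually (\<lambda>n. integrable M (\<lambda>p. (cs n p - c p)\<^sup>2)) sequentially"
      by eventually_elim (use c in \<open>auto simp: integrable_square_iff intro: order.strict_trans\<close>)
    then obtain n where n: "integrable M (\<lambda>p. (cs n p - c p)\<^sup>2)"
      using eventually_happens'[OF sequentially_bot] by blast
    then have n': "integrable M (\<lambda>p. (c p - cs n p)\<^sup>2)" by (simp add: power2_commute)
    have "integrable M (\<lambda>p. ((c p - cs n p) + cs n p)\<^sup>2)"
      by (rule integrable_square_add) (use c n' in auto)
    then show "integrable M (\<lambda>p. (c p)\<^sup>2)" by simp
    have "(\<lambda>n. enn2real (\<integral>\<^sup>+p. ennreal ((cs n p - c p)\<^sup>2) \<partial>M)) \<longlonglongrightarrow> enn2real 0"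
      using c(4) by (intro tendsto_enn2real) auto
    moreover have "(\<integral>p. (cs n p - c p)\<^sup>2 \<partial>M) = enn2real (\<integral>\<^sup>+p. ennreal ((cs n p - c p)\<^sup>2) \<partial>M)" for n
      using c by (intro integral_eq_nn_integral) auto
    ultimately show "(\<lambda>n. \<integral>p. (cs n p - c p)\<^sup>2 \<partial>M) \<longlonglongrightarrow> 0" by simp
  qed
  note a' = ev[OF a] lim[OF a] int[OF a]
  note b' = ev[OF b] lim[OF b] int[OF b]
  define \<alpha> where "\<alpha> n = (\<integral>p. (as n p - a p)\<^sup>2 \<partial>M)" for n
  define \<beta> where "\<beta> n = (\<integral>p. (bs n p - b p)\<^sup>2 \<partial>M)" for n
  define A where "A = (\<integral>p. (a p)\<^sup>2 \<partial>M)"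
  define B where "B = (\<integral>p. (b p)\<^sup>2 \<partial>M)"
  \<comment> \<open>The square root makes both \<open>\<epsilon> n\<close> and
    \<open>(\<alpha> n + \<beta> n) / \<epsilon> n\<close> tend to zero; the second summand keeps
    the weight positive when the errors vanish.\<close>
  define \<epsilon> where "\<epsilon> n = sqrt (\<alpha> n + \<beta> n) + 1 / real (Suc n)" for n
  have nn: "0 \<le> \<alpha> n" "0 \<le> \<beta> n" for n by (simp_all add: \<alpha>_def \<beta>_def)
  have \<epsilon>: "0 < \<epsilon> n" for n
    unfolding \<epsilon>_def using nn[of n] by (intro add_nonneg_pos) auto
  have bound: "eventually (\<lambda>n. \<bar>(\<integral>p. as n p * bs n p \<partial>M) - (\<integral>p. a p * b p \<partial>M)\<bar> \<le>
      (\<alpha> n + \<beta> n) + \<epsilon> n * (A + B) + sqrt (\<alpha> n + \<beta> n)) sequentially"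
    using a'(1) b'(1)
  proof eventually_elim
    case (elim n)
    let ?x = "\<lambda>p. as n p - a p" and ?y = "\<lambda>p. bs n p - b p"
    have i1: "integrable M (\<lambda>p. as n p * bs n p)" "integrable M (\<lambda>p. a p * b p)"
      using a b a' b' by (auto intro: integrable_mult_square)
    have i2: "integrable M (\<lambda>p. ((?x p)\<^sup>2 + (?y p)\<^sup>2) + \<epsilon> n * ((a p)\<^sup>2 + (b p)\<^sup>2) + ((?x p)\<^sup>2 + (?y p)\<^sup>2) / \<epsilon> n)"
      using elim a'(3) b'(3) by simp
    have pt: "\<bar>as n p * bs n p - a p * b p\<bar> \<le>
        ((?x p)\<^sup>2 + (?y p)\<^sup>2) + \<epsilon> n * ((a p)\<^sup>2 + (b p)\<^sup>2) + ((?x p)\<^sup>2 + (?y p)\<^sup>2) / \<epsilon> n" for p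
    proof -
      have "as n p * bs n p - a p * b p = ?x p * ?y p + a p * ?y p + b p * ?x p" by algebra
      then have "\<bar>as n p * bs n p - a p * b p\<bar> \<le> \<bar>?x p * ?y p\<bar> + \<bar>a p * ?y p\<bar> + \<bar>b p * ?x p\<bar>" by linarith
      also have "\<dots> \<le> (1 * (?x p)\<^sup>2 + (?y p)\<^sup>2 / 1) + (\<epsilon> n * (a p)\<^sup>2 + (?y p)\<^sup>2 / \<epsilon> n) + (\<epsilon> n * (b p)\<^sup>2 + (?x p)\<^sup>2 / \<epsilon> n)"
        by (intro add_mono abs_mult_le_weighted \<epsilon>) simp
      finally show ?thesis by (simp add: algebra_simps add_divide_distrib)
    qed
    have "\<bar>(\<integral>p. as n p * bs n p \<partial>M) - (\<integral>p. a p * b p \<partial>M)\<bar> = \<bar>\<integral>p. as n p * bs n p - a p * b p \<partial>M\<bar>"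
      using i1 by simp
    also have "\<dots> \<le> (\<integral>p. \<bar>as n p * bs n p - a p * b p\<bar> \<partial>M)"
      by (rule integral_abs_bound)
    also have "\<dots> \<le> (\<integral>p. ((?x p)\<^sup>2 + (?y p)\<^sup>2) + \<epsilon> n * ((a p)\<^sup>2 + (b p)\<^sup>2) + ((?x p)\<^sup>2 + (?y p)\<^sup>2) / \<epsilon> n \<partial>M)"
      using i1 i2 pt by (intro integral_mono) auto
    also have "\<dots> = (\<alpha> n + \<beta> n) + \<epsilon> n * (A + B) + (\<alpha> n + \<beta> n) / \<epsilon> n"
      using elim a'(3) b'(3) by (simp add: \<alpha>_def \<beta>_def A_def B_def)
    also have "(\<alpha> n + \<beta> n) / \<epsilon> n \<le> sqrt (\<alpha> n + \<beta> n)"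
    proof -
      have "\<alpha> n + \<beta> n = sqrt (\<alpha> n + \<beta> n) * sqrt (\<alpha> n + \<beta> n)" using nn[of n] by simp
      also have "\<dots> \<le> sqrt (\<alpha> n + \<beta> n) * \<epsilon> n"
        using nn[of n] by (intro mult_left_mono) (auto simp: \<epsilon>_def)
      finally show ?thesis using \<epsilon>[of n] by (simp add: pos_divide_le_eq)
    qed
    finally show ?case by simp
  qed
  have "(\<lambda>n. (\<alpha> n + \<beta> n) + \<epsilon> n * (A + B) + sqrt (\<alpha> n + \<beta> n)) \<longlonglongrightarrow>
      (0 + 0) + (sqrt (0 + 0) + 0) * (A + B) + sqrt (0 + 0)"
    unfolding \<epsilon>_def
    by (intro tendsto_intros a'(2)[folded \<alpha>_def] b'(2)[folded \<beta>_def] LIMSEQ_Suc[OF lim_1_over_n])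
  then have "(\<lambda>n. (\<alpha> n + \<beta> n) + \<epsilon> n * (A + B) + sqrt (\<alpha> n + \<beta> n)) \<longlonglongrightarrow> 0" by simp
  then have "(\<lambda>n. (\<integral>p. as n p * bs n p \<partial>M) - (\<integral>p. a p * b p \<partial>M)) \<longlonglongrightarrow> 0"
    by (rule Lim_null_comparison[rotated]) (use bound in simp)
  then show ?thesis by (simp add: LIM_zero_iff)
qed

text \<open>\<open>L2_conv\<close> records measurability of the limit only; adding that of the
  approximants makes the notion stable under sums and rotations.\<close>

definition L2_lim ::
  "real \<Rightarrow> real \<Rightarrow> (nat \<Rightarrow> (real \<times> real) \<times> real \<Rightarrow> real) \<Rightarrow> ((real \<times> real) \<times> real \<Rightarrow> real) \<Rightarrow> bool" where
  "L2_lim R L u g \<longleftrightarrow> (\<forall>n. u n \<in> borel_measurable borel) \<and> L2_conv R L u g"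

lemma L2_lim_iff:
  "L2_lim R L u g \<longleftrightarrow> (\<forall>n. u n \<in> borel_measurable borel) \<and> g \<in> borel_measurable borel \<and>
     (\<lambda>n. \<integral>\<^sup>+p. ennreal ((u n p - g p)\<^sup>2) \<partial>MX R L) \<longlonglongrightarrow> 0"
  by (simp add: L2_lim_def L2_conv_def nn_integral_MX)

lemma tendsto_zero_ennreal_le:
  fixes f :: "nat \<Rightarrow> ennreal"
  assumes "g \<longlonglongrightarrow> 0" "\<And>n. f n \<le> g n"
  shows "f \<longlonglongrightarrow> 0"
  by (rule tendsto_sandwich[OF _ _ tendsto_const assms(1)]) (auto simp: assms(2))

lemma L2_lim_add:
  assumes u: "L2_lim R L u g" and v: "L2_lim R L v h"
  shows "L2_lim R L (\<lambda>n p. u n p + v n p) (\<lambda>p. g p + h p)"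
proof -
  let ?N = "\<lambda>f. \<integral>\<^sup>+p. ennreal ((f p)\<^sup>2) \<partial>MX R L"
  have meas: "u n \<in> borel_measurable borel" "v n \<in> borel_measurable borel"
    "g \<in> borel_measurable borel" "h \<in> borel_measurable borel" for n
    using u v by (auto simp: L2_lim_iff)
  have "?N (\<lambda>p. u n p + v n p - (g p + h p)) \<le> 2 * ?N (\<lambda>p. u n p - g p) + 2 * ?N (\<lambda>p. v n p - h p)" for n
  proof -
    have "?N (\<lambda>p. u n p + v n p - (g p + h p)) = ?N (\<lambda>p. (u n p - g p) + (v n p - h p))"
      by (simp add: algebra_simps)
    also have "\<dots> \<le> 2 * ?N (\<lambda>p. u n p - g p) + 2 * ?N (\<lambda>p. v n p - h p)"
      by (intro nn_integral_square_add_le measurable_MX borel_measurable_diff meas)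
    finally show ?thesis .
  qed
  moreover have "(\<lambda>n. 2 * ?N (\<lambda>p. u n p - g p) + 2 * ?N (\<lambda>p. v n p - h p)) \<longlonglongrightarrow> 2 * 0 + 2 * 0"
    using u v by (intro tendsto_add ennreal_tendsto_cmult) (auto simp: L2_lim_iff)
  ultimately have "(\<lambda>n. ?N (\<lambda>p. u n p + v n p - (g p + h p))) \<longlonglongrightarrow> 0"
    by (intro tendsto_zero_ennreal_le[where f = "\<lambda>n. ?N (\<lambda>p. u n p + v n p - (g p + h p))"]) auto
  then show ?thesis using meas by (simp add: L2_lim_iff)
qed

lemma L2_lim_cmult:
  assumes u: "L2_lim R L u g"
  shows "L2_lim R L (\<lambda>n p. c * u n p) (\<lambda>p. c * g p)"
proof -
  have meas: "u n \<in> borel_measurable borel" "g \<in> borel_measurable borel" for n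
    using u by (auto simp: L2_lim_iff)
  have "(\<integral>\<^sup>+p. ennreal ((c * u n p - c * g p)\<^sup>2) \<partial>MX R L) =
      ennreal (c\<^sup>2) * (\<integral>\<^sup>+p. ennreal ((u n p - g p)\<^sup>2) \<partial>MX R L)" for n
  proof -
    have "(\<integral>\<^sup>+p. ennreal ((c * u n p - c * g p)\<^sup>2) \<partial>MX R L) =
       (\<integral>\<^sup>+p. ennreal (c\<^sup>2) * ennreal ((u n p - g p)\<^sup>2) \<partial>MX R L)"
      by (simp add: ennreal_mult[symmetric] power_mult_distrib[symmetric] right_diff_distrib)
    also have "\<dots> = ennreal (c\<^sup>2) * (\<integral>\<^sup>+p. ennreal ((u n p - g p)\<^sup>2) \<partial>MX R L)"
      by (intro nn_integral_cmult measurable_compose[OF _ measurable_ennreal] borel_measurable_power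
          borel_measurable_diff measurable_MX meas)
    finally show ?thesis .
  qed
  moreover have "(\<lambda>n. ennreal (c\<^sup>2) * (\<integral>\<^sup>+p. ennreal ((u n p - g p)\<^sup>2) \<partial>MX R L)) \<longlonglongrightarrow> ennreal (c\<^sup>2) * 0"
    using u by (intro ennreal_tendsto_cmult) (auto simp: L2_lim_iff)
  ultimately show ?thesis using meas by (simp add: L2_lim_iff)
qed

lemma L2_lim_diff:
  "L2_lim R L u g \<Longrightarrow> L2_lim R L v h \<Longrightarrow> L2_lim R L (\<lambda>n p. u n p - v n p) (\<lambda>p. g p - h p)"
  using L2_lim_add[of R L u g "\<lambda>n p. (-1) * v n p" "\<lambda>p. (-1) * h p"] L2_lim_cmult[of R L v h "-1"] by simp

lemma L2_lim_sum:
  assumes "finite I" "\<And>i. i \<in> I \<Longrightarrow> L2_lim R L (u i) (g i)"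
  shows "L2_lim R L (\<lambda>n p. \<Sum>i\<in>I. u i n p) (\<lambda>p. \<Sum>i\<in>I. g i p)"
  using assms
proof (induction I)
  case empty
  then show ?case by (simp add: L2_lim_iff)
next
  case (insert i I)
  then show ?case using L2_lim_add[of R L "u i" "g i"] by simp
qed

text \<open>Rotations preserve the measure and so the distance between approximant and
  limit.\<close>

lemma L2_lim_Tz:
  assumes u: "L2_lim R L u g" and h: "0 \<le> h" "h \<le> L"
  shows "L2_lim R L (\<lambda>n p. u n (Tz L h p)) (\<lambda>p. g (Tz L h p))"
proof -
  have meas: "u n \<in> borel_measurable borel" "g \<in> borel_measurable borel" for n
    using u by (auto simp: L2_lim_iff)
  have "(\<integral>\<^sup>+p. ennreal ((u n (Tz L h p) - g (Tz L h p))\<^sup>2) \<partial>MX R L) =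
      (\<integral>\<^sup>+p. ennreal ((u n p - g p)\<^sup>2) \<partial>MX R L)" for n
    by (rule nn_integral_Tz[OF _ h]) (intro measurable_compose[OF _ measurable_ennreal] borel_measurable_power
          borel_measurable_diff meas)
  then show ?thesis
    using u meas measurable_compose[OF Tz_borel meas(1)] measurable_compose[OF Tz_borel meas(2)]
    by (simp add: L2_lim_iff)
qed

section \<open>Rotation invariance of the derivative\<close>

lemma zdir_in_Basis: "zdir \<in> Basis"
  by (auto simp: zdir_def Basis_prod_def zero_prod_def[symmetric])

lemma adm_square_integrable: "adm R L f \<Longrightarrow> 0 < L \<Longrightarrow> integrable (MX R L) (\<lambda>p. (f p)\<^sup>2)"
  by (intro adm_integrable adm_power2)

text \<open>Integration by parts produces minus the full gradient energy of the increment, of which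
  the \<open>zdir\<close> part is kept; the Poincare inequality absorbs the zero-order term. The
  right-hand side stays unevaluated because approximants need not solve the equation; its sign
  appears only in the limit.\<close>

lemma energy_le:
  fixes h :: real
  assumes f: "smooth_fun f" "adm R L f" and L: "0 < L"
  defines "inc \<equiv> \<lambda>g p. g (p + ((0, 0), h)) - g p"
  shows "(1 - c\<^sup>2 * L\<^sup>2) * (\<integral>p. (inc (Dir f zdir) p)\<^sup>2 \<partial>MX R L) \<le>
    - (\<integral>p. inc f p * (inc (\<lambda>p. \<Sum>b\<in>Basis. Dir (Dir f b) b p) p + c\<^sup>2 * inc f p) \<partial>MX R L)"
proof -
  have adm: "adm R L (inc g)" if "adm R L g" for g
    unfolding inc_def by (intro adm_diff adm_shift that)
  have D1: "adm R L (Dir f b)" "adm R L (Dir (Dir f b) b)" for b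
    using f by (auto intro: adm_Dir smooth_fun_Dir)
  \<comment> \<open>Taking increments commutes with differentiation, since translations do.\<close>
  have dd: "has_dd b (inc g) (inc (Dir g b))" if "smooth_fun g" for g b
    unfolding inc_def by (intro has_dd_diff has_dd_shift smooth_fun_has_dd that)
  have parts: "(\<integral>p. inc f p * inc (Dir (Dir f b) b) p \<partial>MX R L) = - (\<integral>p. (inc (Dir f b) p)\<^sup>2 \<partial>MX R L)"
    if "b \<in> Basis" for b
    by (rule integral_by_parts[OF adm adm adm dd dd that L]) (auto intro: f D1 smooth_fun_Dir)
  have lap: "inc (\<lambda>p. \<Sum>b\<in>Basis. Dir (Dir f b) b p) p = (\<Sum>b\<in>Basis. inc (Dir (Dir f b) b) p)" for p
    by (simp add: inc_def sum_subtractf)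
  have intb: "integrable (MX R L) (\<lambda>p. inc f p * inc (Dir (Dir f b) b) p)" for b
    by (intro adm_integrable adm_mult adm f D1 L)
  have int2: "integrable (MX R L) (\<lambda>p. (inc g p)\<^sup>2)" if "adm R L g" for g
    by (intro adm_square_integrable adm that L)
  have "(\<integral>p. inc f p * (inc (\<lambda>p. \<Sum>b\<in>Basis. Dir (Dir f b) b p) p + c\<^sup>2 * inc f p) \<partial>MX R L) =
      (\<integral>p. (\<Sum>b\<in>Basis. inc f p * inc (Dir (Dir f b) b) p) + c\<^sup>2 * (inc f p)\<^sup>2 \<partial>MX R L)"
    unfolding lap by (simp add: distrib_left sum_distrib_left power2_eq_square mult_ac)
  also have "\<dots> = (\<Sum>b\<in>Basis. \<integral>p. inc f p * inc (Dir (Dir f b) b) p \<partial>MX R L) + c\<^sup>2 * (\<integral>p. (inc f p)\<^sup>2 \<partial>MX R L)"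
    using intb int2[OF f(2)] by simp
  also have "\<dots> = - (\<Sum>b\<in>Basis. \<integral>p. (inc (Dir f b) p)\<^sup>2 \<partial>MX R L) + c\<^sup>2 * (\<integral>p. (inc f p)\<^sup>2 \<partial>MX R L)"
    by (simp add: parts sum_negf)
  also have "\<dots> \<le> - (\<integral>p. (inc (Dir f zdir) p)\<^sup>2 \<partial>MX R L) + c\<^sup>2 * (L\<^sup>2 * (\<integral>p. (inc (Dir f zdir) p)\<^sup>2 \<partial>MX R L))"
  proof (intro add_mono mult_left_mono le_imp_neg_le)
    show "(\<integral>p. (inc (Dir f zdir) p)\<^sup>2 \<partial>MX R L) \<le> (\<Sum>b\<in>Basis. \<integral>p. (inc (Dir f b) p)\<^sup>2 \<partial>MX R L)"
      by (rule member_le_sum[OF zdir_in_Basis]) auto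
    have "\<exists>y\<in>{0..L}. inc f (x, y) = 0" for x
      unfolding inc_def by (rule adm_increment_zero[OF f(2) L])
    then have "(\<integral>\<^sup>+p. ennreal ((inc f p)\<^sup>2) \<partial>MX R L) \<le>
        ennreal (L\<^sup>2) * (\<integral>\<^sup>+p. ennreal ((inc (Dir f zdir) p)\<^sup>2) \<partial>MX R L)"
      by (intro poincare_MX adm f D1 dd L)
    then show "(\<integral>p. (inc f p)\<^sup>2 \<partial>MX R L) \<le> L\<^sup>2 * (\<integral>p. (inc (Dir f zdir) p)\<^sup>2 \<partial>MX R L)"
      using int2[OF f(2)] int2[OF D1(1)]
      by (simp add: nn_integral_eq_integral ennreal_mult[symmetric] ennreal_le_iff)
  qed simp
  finally show ?thesis by (simp add: algebra_simps)
qed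

section \<open>One-variable calculus for the potential\<close>

lemma smooth_fun_real_deriv:
  fixes V :: "real \<Rightarrow> real"
  assumes "smooth_fun V"
  shows "(deriv V has_real_derivative deriv (deriv V) t) (at t)"
proof -
  have D: "(g has_real_derivative Dir g 1 t) (at t)" if "smooth_fun g" for g :: "real \<Rightarrow> real" and t
  proof -
    have "((\<lambda>s. g (0 + s *\<^sub>R 1)) has_real_derivative Dir g 1 (0 + t *\<^sub>R 1)) (at t)"
      using smooth_fun_has_dd[OF that, of 1] unfolding has_dd_def by blast
    then show ?thesis by simp
  qed
  then have "deriv V = Dir V 1"
    using assms by (auto intro!: DERIV_imp_deriv)
  then show ?thesis
    using D[OF smooth_fun_Dir[OF assms]] DERIV_imp_deriv by metis
qed

text \<open>The lower bound on the second derivative makes \<open>deriv V t + c\<^sup>2 * t\<close>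
  nondecreasing, so its increments have the sign of the increments of \<open>t\<close>.\<close>

lemma semiconvex_monotone:
  fixes V :: "real \<Rightarrow> real"
  assumes V: "smooth_fun V" and c: "\<And>t. deriv (deriv V) t \<ge> - c\<^sup>2"
  shows "0 \<le> (t - s) * (deriv V t - deriv V s + c\<^sup>2 * (t - s))"
proof -
  define W where "W t = deriv V t + c\<^sup>2 * t" for t
  have mono: "W x \<le> W y" if "x \<le> y" for x y
  proof (rule DERIV_nonneg_imp_nondecreasing[OF that])
    fix t
    have "(W has_real_derivative (deriv (deriv V) t + c\<^sup>2)) (at t)"
      unfolding W_def by (auto intro!: derivative_eq_intros smooth_fun_real_deriv[OF V])
    then show "\<exists>y. (W has_real_derivative y) (at t) \<and> 0 \<le> y"
      using c[of t] by (intro exI[of _ "deriv (deriv V) t + c\<^sup>2"]) auto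
  qed
  have "0 \<le> (t - s) * (W t - W s)"
    using mono[of s t] mono[of t s] by (cases "s \<le> t") (auto intro: mult_nonneg_nonneg mult_nonpos_nonpos)
  then show ?thesis by (simp add: W_def algebra_simps)
qed

text \<open>The energy estimate holds for the approximants, and its right-hand side converges to a
  nonpositive number by the equation and monotonicity. As \<open>1 - c\<^sup>2 * L\<^sup>2\<close>
  is positive, the energies of the increments tend to zero.\<close>

lemma Gz_translation_invariant:
  assumes V: "smooth_fun V" "\<And>t. deriv (deriv V) t \<ge> - c\<^sup>2"
    and L: "0 < L" "c\<^sup>2 * L\<^sup>2 < 1" and h: "0 \<le> h" "h \<le> L"
    and approx: "H2_0_approx R L fs phi G H"
    and pde: "AE p in MX R L. weak_laplacian H p = deriv V (phi p)"
  shows "AE p in MX R L. G zdir (Tz L h p) = G zdir p"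
proof -
  have test: "test_fun R L (fs n)" for n using approx by (simp add: H2_0_approx_def)
  then have f: "smooth_fun (fs n)" "adm R L (fs n)" for n
    by (auto simp: test_fun_def intro: test_fun_adm)
  have D: "adm R L (Dir (fs n) b)" "adm R L (Dir (Dir (fs n) b) b)" for n b
    using f[of n] by (auto intro: adm_Dir smooth_fun_Dir)
  let ?lap = "\<lambda>n p. \<Sum>b\<in>Basis. Dir (Dir (fs n) b) b p"
  have lap: "adm R L (?lap n)" for n
    by (intro adm_sum D) auto
  define inc where "inc = (\<lambda>(g :: (real \<times> real) \<times> real \<Rightarrow> real) p. g (p + ((0, 0), h)) - g p)"
  have adm_inc: "adm R L (inc g)" if "adm R L g" for g
    unfolding inc_def by (intro adm_diff adm_shift that)
  have lim_inc: "L2_lim R L (\<lambda>n. inc (u n)) (\<lambda>p. g (Tz L h p) - g p)"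
    if "\<And>n. adm R L (u n)" "L2_conv R L u g" for u g
  proof -
    have "L2_lim R L u g" using that(2) adm_borel[OF that(1)] by (simp add: L2_lim_def)
    from L2_lim_diff[OF L2_lim_Tz[OF this h] this] show ?thesis
      by (simp add: inc_def[abs_def] adm_Tz[OF that(1)])
  qed
  have conv: "L2_conv R L fs phi" "L2_conv R L (\<lambda>n. Dir (fs n) zdir) (G zdir)"
    "\<And>b. b \<in> Basis \<Longrightarrow> L2_conv R L (\<lambda>n. Dir (Dir (fs n) b) b) (H b b)"
    using approx zdir_in_Basis by (auto simp: H2_0_approx_def)
  have "L2_lim R L ?lap (weak_laplacian H)"
    unfolding weak_laplacian_def[abs_def]
    by (intro L2_lim_sum) (auto simp: L2_lim_def conv adm_borel[OF D(2)])
  then have conv_lap: "L2_conv R L ?lap (weak_laplacian H)" by (simp add: L2_lim_def)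
  define a where "a p = phi (Tz L h p) - phi p" for p
  \<comment> \<open>By the equation \<open>q\<close> is almost everywhere the increment of
    \<open>deriv V t + c\<^sup>2 * t\<close> between the values \<open>phi p\<close> and
    \<open>phi (Tz L h p)\<close>, so \<open>a * q\<close> is nonnegative.\<close>
  define q where "q p = (weak_laplacian H (Tz L h p) - weak_laplacian H p) + c\<^sup>2 * a p" for p
  define qs where "qs n p = inc (?lap n) p + c\<^sup>2 * inc (fs n) p" for n p
  define E where "E n = (\<integral>p. (inc (Dir (fs n) zdir) p)\<^sup>2 \<partial>MX R L)" for n
  have la: "L2_lim R L (\<lambda>n. inc (fs n)) a"
    unfolding a_def[abs_def] by (rule lim_inc[OF f(2) conv(1)])
  have lq: "L2_lim R L qs q"
    unfolding qs_def[abs_def] q_def[abs_def]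
    by (intro L2_lim_add L2_lim_cmult la lim_inc lap conv_lap)
  have adm_qs: "adm R L (qs n)" for n
    unfolding qs_def by (intro adm_add adm_cmult adm_inc lap f)
  have "(\<lambda>n. \<integral>p. inc (fs n) p * qs n p \<partial>MX R L) \<longlonglongrightarrow> (\<integral>p. a p * q p \<partial>MX R L)"
    using la lq by (intro L2_limit_integral_mult)
      (auto simp: L2_lim_iff intro!: measurable_MX adm_square_integrable adm_inc f adm_qs L)
  moreover have "0 \<le> (\<integral>p. a p * q p \<partial>MX R L)"
  proof (rule integral_nonneg_AE)
    show "AE p in MX R L. 0 \<le> a p * q p"
      using pde AE_Tz[OF h pde]
    proof eventually_elim
      case (elim p)
      then show ?case
        using semiconvex_monotone[OF V, of "phi (Tz L h p)" "phi p"] by (simp add: a_def q_def)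
    qed
  qed
  moreover have kE: "(1 - c\<^sup>2 * L\<^sup>2) * E n \<le> - (\<integral>p. inc (fs n) p * qs n p \<partial>MX R L)" for n
    unfolding E_def qs_def inc_def by (rule energy_le[OF f L(1)])
  have E0: "0 \<le> E n" for n by (simp add: E_def)
  have "E \<longlonglongrightarrow> 0"
  proof -
    let ?I = "\<lambda>n. \<integral>p. inc (fs n) p * qs n p \<partial>MX R L" and ?J = "\<integral>p. a p * q p \<partial>MX R L"
    have "(\<lambda>n. \<bar>?I n - ?J\<bar> / (1 - c\<^sup>2 * L\<^sup>2)) \<longlonglongrightarrow> \<bar>?J - ?J\<bar> / (1 - c\<^sup>2 * L\<^sup>2)"
      using L(2) by (intro tendsto_intros calculation(1)) auto
    then have "(\<lambda>n. \<bar>?I n - ?J\<bar> / (1 - c\<^sup>2 * L\<^sup>2)) \<longlonglongrightarrow> 0" by simp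
    then show ?thesis
    proof (rule Lim_null_comparison[rotated], intro always_eventually allI)
      fix n
      \<comment> \<open>As \<open>?J\<close> is nonnegative, \<open>- ?I n\<close> is at most
        \<open>?J - ?I n\<close>.\<close>
      have "(1 - c\<^sup>2 * L\<^sup>2) * E n \<le> \<bar>?I n - ?J\<bar>" using kE[of n] calculation(2) by linarith
      then show "norm (E n) \<le> \<bar>?I n - ?J\<bar> / (1 - c\<^sup>2 * L\<^sup>2)"
        using L(2) E0[of n] by (simp add: pos_le_divide_eq mult.commute)
    qed
  qed
  define g where "g p = G zdir (Tz L h p) - G zdir p" for p
  let ?N = "\<lambda>f. \<integral>\<^sup>+p. ennreal ((f p)\<^sup>2) \<partial>MX R L"
  have lg: "L2_lim R L (\<lambda>n. inc (Dir (fs n) zdir)) g"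
    unfolding g_def[abs_def] by (rule lim_inc[OF D(1) conv(2)])
  have gm: "g \<in> borel_measurable borel" using lg by (simp add: L2_lim_iff)
  have le: "?N g \<le> 2 * ?N (\<lambda>p. inc (Dir (fs n) zdir) p - g p) + 2 * ennreal (E n)" for n
  proof -
    let ?u = "inc (Dir (fs n) zdir)"
    have u: "adm R L ?u" by (intro adm_inc D)
    have "?N g = ?N (\<lambda>p. (g p - ?u p) + ?u p)" by simp
    also have "\<dots> \<le> 2 * ?N (\<lambda>p. g p - ?u p) + 2 * ?N ?u"
      by (intro nn_integral_square_add_le measurable_MX borel_measurable_diff gm adm_borel[OF u])
    also have "?N ?u = ennreal (E n)"
      unfolding E_def using adm_square_integrable[OF u L(1)] by (intro nn_integral_eq_integral) auto
    finally show ?thesis by (simp add: power2_commute)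
  qed
  have "(\<lambda>n. 2 * ?N (\<lambda>p. inc (Dir (fs n) zdir) p - g p) + 2 * ennreal (E n)) \<longlonglongrightarrow> 2 * 0 + 2 * ennreal 0"
    using lg by (intro tendsto_add ennreal_tendsto_cmult tendsto_ennrealI \<open>E \<longlonglongrightarrow> 0\<close>) (auto simp: L2_lim_iff)
  then have "?N g \<le> 2 * 0 + 2 * ennreal 0"
    by (rule LIMSEQ_le_const) (use le in blast)
  then have "?N g = 0" by simp
  then have "AE p in MX R L. ennreal ((g p)\<^sup>2) = 0"
    by (subst (asm) nn_integral_0_iff_AE)
      (intro measurable_compose[OF _ measurable_ennreal] borel_measurable_power measurable_MX gm)
  then show ?thesis by eventually_elim (simp add: g_def)
qed

theorem theorem3p1:
  fixes R :: real and V :: "real \<Rightarrow> real"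
  assumes "R > 0"
    and "smooth_fun V"
    and "\<exists>cV>0. \<forall>t. t * deriv V t \<ge> - cV\<^sup>2 \<and> deriv (deriv V) t \<ge> - cV\<^sup>2"
  shows "\<exists>L0>0. \<forall>L. 0 < L \<and> L < L0 \<longrightarrow>
           (\<forall>phi fs G H. H2_0_approx R L fs phi G H \<and>
              (AE p in lborel. p \<in> XL R L \<longrightarrow> weak_laplacian H p - deriv V (phi p) = 0)
              \<longrightarrow> (AE p in lborel. p \<in> XL R L \<longrightarrow> G zdir p = 0))"
proof -
  obtain c where c: "c > 0" "\<And>t. deriv (deriv V) t \<ge> - c\<^sup>2" using assms(3) by blast
  have "AE p in lborel. p \<in> XL R L \<longrightarrow> G zdir p = 0"
    if L: "0 < L" "L < 1 / c" and approx: "H2_0_approx R L fs phi G H"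
      and pde: "AE p in lborel. p \<in> XL R L \<longrightarrow> weak_laplacian H p - deriv V (phi p) = 0"
    for L phi fs G H
  proof -
    \<comment> \<open>The threshold \<open>1 / c\<close> is what makes the coefficient in the energy
      estimate positive.\<close>
    have "c * L < 1" using L c by (simp add: field_simps)
    then have "(c * L)\<^sup>2 < 1\<^sup>2" using L c by (intro power_strict_mono) auto
    then have cL: "c\<^sup>2 * L\<^sup>2 < 1" by (simp add: power_mult_distrib)
    have pde': "AE p in MX R L. weak_laplacian H p = deriv V (phi p)"
      using pde by (simp add: AE_MX)
    have inv: "AE p in MX R L. G zdir (Tz L h p) = G zdir p" if "0 \<le> h" "h \<le> L" for h
      by (rule Gz_translation_invariant[OF assms(2) c(2) L(1) cL that approx pde'])
    let ?N = "\<lambda>f. \<integral>\<^sup>+p. ennreal ((f p)\<^sup>2) \<partial>MX R L"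
    let ?D = "\<lambda>n. Dir (fs n) zdir"
    have f: "smooth_fun (fs n)" "adm R L (fs n)" for n
      using approx by (auto simp: H2_0_approx_def test_fun_def intro: test_fun_adm)
    have D: "adm R L (?D n)" for n by (rule adm_Dir[OF f])
    have lim: "L2_lim R L ?D (G zdir)"
      using approx zdir_in_Basis by (auto simp: L2_lim_def H2_0_approx_def adm_borel[OF D])
    then have Gm: "G zdir \<in> borel_measurable borel" by (simp add: L2_lim_iff)
    have diff_meas: "(\<lambda>p. ?D n p - G zdir p) \<in> borel_measurable borel" for n
      by (intro borel_measurable_diff Gm adm_borel[OF D])
    \<comment> \<open>Since \<open>G zdir\<close> is rotation invariant, subtracting it from
      \<open>?D n\<close> leaves the increment unchanged almost everywhere. The exceptional set may
      depend on \<open>h\<close>, which is harmless as \<open>h\<close> is fixed in this integral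
      over \<open>p\<close>.\<close>
    have shift_le: "?N (\<lambda>p. ?D n (p + ((0, 0), h)) - ?D n p) \<le> 4 * ?N (\<lambda>p. ?D n p - G zdir p)"
      if h: "0 \<le> h" "h \<le> L" for n h
    proof -
      let ?g = "\<lambda>p. ?D n p - G zdir p"
      have "?N (\<lambda>p. ?D n (p + ((0, 0), h)) - ?D n p) = ?N (\<lambda>p. ?g (Tz L h p) + - ?g p)"
        using inv[OF h] by (intro nn_integral_cong_AE, eventually_elim) (simp add: adm_Tz[OF D])
      also have "\<dots> \<le> 2 * ?N (\<lambda>p. ?g (Tz L h p)) + 2 * ?N (\<lambda>p. - ?g p)"
        by (intro nn_integral_square_add_le measurable_MX borel_measurable_uminus diff_meas
            measurable_compose[OF Tz_borel diff_meas])
      also have "?N (\<lambda>p. ?g (Tz L h p)) = ?N ?g"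
        by (rule nn_integral_Tz[OF _ h]) (intro measurable_compose[OF _ measurable_ennreal]
            borel_measurable_power diff_meas)
      also have "?N (\<lambda>p. - ?g p) = ?N ?g" by (simp add: power2_commute)
      also have "2 * ?N ?g + 2 * ?N ?g = 4 * ?N ?g"
        by (simp add: distrib_right[symmetric])
      finally show ?thesis .
    qed
    \<comment> \<open>The bound on the increments is uniform in \<open>h\<close>, so integrating it
      over a period gives a factor \<open>L\<close>, which cancels.\<close>
    have D_le: "?N (?D n) \<le> 4 * ?N (\<lambda>p. ?D n p - G zdir p)" for n
    proof -
      have "ennreal L * ?N (?D n) \<le>
          (\<integral>\<^sup>+h. ?N (\<lambda>p. ?D n (p + ((0, 0), h)) - ?D n p) * indicator {0..L} h \<partial>lborel)"
        by (rule mean_zero_MX[OF f(2) D smooth_fun_has_dd[OF f(1)] L(1)])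
      also have "\<dots> \<le> (\<integral>\<^sup>+h. 4 * ?N (\<lambda>p. ?D n p - G zdir p) * indicator {0..L} h \<partial>lborel)"
        using shift_le by (intro nn_integral_mono) (simp add: indicator_def)
      also have "\<dots> = ennreal L * (4 * ?N (\<lambda>p. ?D n p - G zdir p))"
        using L(1) by (subst nn_integral_cmult_indicator) (auto simp: mult.commute)
      finally show ?thesis
        using L(1) by (subst (asm) ennreal_mult_le_mult_iff) auto
    qed
    \<comment> \<open>The mean-zero estimate is available for \<open>?D n\<close> only and reaches
      \<open>G zdir\<close> by the triangle inequality; the constant is
      \<open>2 * 4 + 2\<close>.\<close>
    have le: "?N (G zdir) \<le> 10 * ?N (\<lambda>p. ?D n p - G zdir p)" for n
    proof -
      have "?N (G zdir) = ?N (\<lambda>p. ?D n p + - (?D n p - G zdir p))" by simp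
      also have "\<dots> \<le> 2 * ?N (?D n) + 2 * ?N (\<lambda>p. - (?D n p - G zdir p))"
        by (intro nn_integral_square_add_le measurable_MX borel_measurable_uminus diff_meas adm_borel[OF D])
      also have "\<dots> \<le> 2 * (4 * ?N (\<lambda>p. ?D n p - G zdir p)) + 2 * ?N (\<lambda>p. ?D n p - G zdir p)"
        by (intro add_mono mult_left_mono D_le) (simp_all add: power2_commute)
      also have "\<dots> = 10 * ?N (\<lambda>p. ?D n p - G zdir p)"
        by (simp add: mult.assoc[symmetric] distrib_right[symmetric])
      finally show ?thesis .
    qed
    have "(\<lambda>n. 10 * ?N (\<lambda>p. ?D n p - G zdir p)) \<longlonglongrightarrow> 10 * 0"
      using lim by (intro ennreal_tendsto_cmult) (auto simp: L2_lim_iff)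
    then have "?N (G zdir) \<le> 10 * 0"
      by (rule LIMSEQ_le_const) (use le in blast)
    then have "?N (G zdir) = 0" by simp
    then have "AE p in MX R L. ennreal ((G zdir p)\<^sup>2) = 0"
      by (subst (asm) nn_integral_0_iff_AE)
        (intro measurable_compose[OF _ measurable_ennreal] borel_measurable_power measurable_MX Gm)
    then show ?thesis by (simp add: AE_MX)
  qed
  then show ?thesis using c(1)
    by (intro exI[of _ "1 / c"] conjI allI impI) (simp, blast)
qed

end
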